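(* Let $T$ be the operator \[ Tf(x)=f(x)-\int_0^xf(y)\,dy \] defined on the Hilbert space $L^2(\mathbb R_+,e^{-x}\,dx)$, and let $\{L_n\}_{n\ge0}$ be the system of Laguerre polynomials. Assume that $f\in L^2(\mathbb R_+,e^{-x}\,dx)$ has absolutely summable Laguerre coefficients, i.e. $\sum_{n\ge0}\big|\int_0^{+\infty}f(x)L_n(x)e^{-x}\,dx\big|<+\infty$. Then, for every $\eta>0$ and for almost every $x\in\mathbb R_+$, \[ \lim_{N\to+\infty}\frac{\sqrt N}{(\log(1+N))^{\frac32+\eta}}\bigg|\frac1N\sum_{n=0}^{N-1}T^nf(x)\bigg|=0 . \]
   Context: The Laguerre polynomials are $L_n(x)=\frac{e^x}{n!}\frac{d^n}{dx^n}(e^{-x}x^n)=\sum_{k=0}^n\binom nk\frac{(-1)^k}{k!}x^k$, $n=0,1,2,\dots$; they form an orthonormal basis of $L^2(\mathbb R_+,e^{-x}\,dx)$, where $\mathbb R_+=[0,+\infty)$. *)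

theory Defs
  imports "HOL-Analysis.Analysis"
begin

definition laguerre :: "nat \<Rightarrow> real \<Rightarrow> real" where
  "laguerre n x = exp x / fact n * (deriv ^^ n) (\<lambda>t. exp (- t) * t ^ n) x"

lemma deriv_exp_mult_power:
  "(deriv ^^ k) (\<lambda>t::real. exp (- t) * t ^ n) =
     (\<lambda>t. exp (- t) * (\<Sum>j\<le>k. of_nat (k choose j) * (- 1) ^ (k - j) *
       (of_nat (\<Prod>i<j. n - i) * t ^ (n - j))))"
proof (induction k)
  case 0
  then show ?case by simp
next
  case (Suc k)
  define g :: "nat \<Rightarrow> real \<Rightarrow> real"
    where "g j t = of_nat (\<Prod>i<j. n - i) * t ^ (n - j)" for j t
  have g': "(g j has_field_derivative g (Suc j) t) (at t)" for j t
    unfolding g_def by (auto intro!: derivative_eq_intros)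
  define c :: "nat \<Rightarrow> nat \<Rightarrow> real"
    where "c k j = of_nat (k choose j) * (- 1) ^ (k - j)" for k j
  have pascal: "(\<Sum>j\<le>k. c k j * g (Suc j) t) - (\<Sum>j\<le>k. c k j * g j t) =
      (\<Sum>j\<le>Suc k. c (Suc k) j * g j t)" for t
  proof -
    have c_Suc: "c (Suc k) (Suc j) = c k j - (if j < k then c k (Suc j) else 0)" if "j \<le> k" for j
    proof (cases "j < k")
      case True
      then have "k - j = Suc (k - Suc j)" by simp
      then show ?thesis using True by (simp add: c_def algebra_simps)
    next
      case False
      with that show ?thesis by (simp add: c_def)
    qed
    have "(\<Sum>j\<le>Suc k. c (Suc k) j * g j t) =
        c (Suc k) 0 * g 0 t + (\<Sum>j\<le>k. c (Suc k) (Suc j) * g (Suc j) t)"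
      by (subst sum.atMost_Suc_shift) simp
    also have "(\<Sum>j\<le>k. c (Suc k) (Suc j) * g (Suc j) t) =
        (\<Sum>j\<le>k. c k j * g (Suc j) t) - (\<Sum>j\<le>k. if j < k then c k (Suc j) * g (Suc j) t else 0)"
      unfolding sum_subtractf [symmetric]
      by (rule sum.cong) (auto simp: c_Suc algebra_simps)
    also have "(\<Sum>j\<le>k. if j < k then c k (Suc j) * g (Suc j) t else 0) =
        (\<Sum>j<k. c k (Suc j) * g (Suc j) t)"
      by (rule sum.mono_neutral_cong_right) auto
    also have "(\<Sum>j<k. c k (Suc j) * g (Suc j) t) = (\<Sum>j\<le>k. c k j * g j t) - c k 0 * g 0 t"
      using sum.lessThan_Suc_shift [of "\<lambda>j. c k j * g j t" k]
      by (simp only: lessThan_Suc_atMost)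
    finally show ?thesis by (simp add: c_def)
  qed
  have "((\<lambda>t. exp (- t) * (\<Sum>j\<le>k. c k j * g j t)) has_field_derivative
      exp (- t) * (\<Sum>j\<le>Suc k. c (Suc k) j * g j t)) (at t)" for t
    unfolding pascal [symmetric]
    by (auto intro!: derivative_eq_intros DERIV_sum g' simp: algebra_simps)
  then have "deriv (\<lambda>t. exp (- t) * (\<Sum>j\<le>k. c k j * g j t)) =
      (\<lambda>t. exp (- t) * (\<Sum>j\<le>Suc k. c (Suc k) j * g j t))"
    by (intro ext DERIV_imp_deriv)
  with Suc show ?case by (simp only: funpow.simps comp_def g_def c_def)
qed

lemma laguerre_eq_sum:
  "laguerre n x = (\<Sum>k\<le>n. of_nat (n choose k) * ((- 1) ^ k / fact k) * x ^ k)"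
proof -
  have ff: "real (\<Prod>i<j. n - i) = fact n / fact (n - j)" if "j \<le> n" for j
    using that
  proof (induction j)
    case (Suc j)
    then have "n - j = Suc (n - Suc j)" by simp
    then have "fact (n - j) = real (n - j) * fact (n - Suc j)"
      by (metis fact_Suc of_nat_mult)
    with Suc show ?case by (simp add: field_simps)
  qed simp
  have "laguerre n x = (\<Sum>j\<le>n. of_nat (n choose j) * (- 1) ^ (n - j) *
      (of_nat (\<Prod>i<j. n - i) * x ^ (n - j)) / fact n)"
    unfolding laguerre_def deriv_exp_mult_power sum_divide_distrib [symmetric]
    by (simp add: exp_minus)
  also have "\<dots> = (\<Sum>j\<le>n. of_nat (n choose (n - j)) * ((- 1) ^ (n - j) / fact (n - j)) * x ^ (n - j))"
  proof (rule sum.cong)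
    fix j assume "j \<in> {..n}"
    then have j: "j \<le> n" by simp
    show "of_nat (n choose j) * (- 1) ^ (n - j) * (of_nat (\<Prod>i<j. n - i) * x ^ (n - j)) / fact n =
        of_nat (n choose (n - j)) * ((- 1) ^ (n - j) / fact (n - j)) * x ^ (n - j)"
      unfolding ff [OF j] by (simp add: binomial_symmetric [OF j])
  qed simp
  also have "\<dots> = (\<Sum>k\<le>n. of_nat (n choose k) * ((- 1) ^ k / fact k) * x ^ k)"
    using sum.nat_diff_reindex [of "\<lambda>k. of_nat (n choose k) * ((- 1) ^ k / fact k) * x ^ k" "Suc n"]
    by (simp add: lessThan_Suc_atMost)
  finally show ?thesis .
qed

definition exp_weight :: "real measure" where
  "exp_weight = density (lebesgue_on {0..}) (\<lambda>x. ennreal (exp (- x)))"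

text \<open>
  Elements of the (complex) Hilbert space are represented by functions rather than by classes of
  functions that agree almost everywhere. Values at negative arguments are irrelevant.
\<close>

definition L2_exp_weight :: "(real \<Rightarrow> complex) set" where
  "L2_exp_weight =
     {f \<in> borel_measurable exp_weight. integrable exp_weight (\<lambda>x. (cmod (f x))\<^sup>2)}"

definition laguerre_coeff :: "(real \<Rightarrow> complex) \<Rightarrow> nat \<Rightarrow> complex" where
  "laguerre_coeff f n = (LINT x|exp_weight. f x * complex_of_real (laguerre n x))"

text \<open>
  The integral is with respect to \<^const>\<open>lebesgue\<close> and not \<^const>\<open>lborel\<close>, since representatives
  are only Lebesgue measurable. The weight is bounded below on bounded intervals, so every
  function in \<^const>\<open>L2_exp_weight\<close> is integrable on \<open>{0..x}\<close>; changing the representative on a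
  null set changes the result only on that null set.
\<close>

definition volterra_T :: "(real \<Rightarrow> complex) \<Rightarrow> real \<Rightarrow> complex" where
  "volterra_T f x = f x - (LINT y:{0..x}|lebesgue. f y)"

end

(* The operator shifts the Laguerre basis, because integrating L_n from 0 to x gives
   L_n(x) - L_{n+1}(x). Hence T^n f is almost everywhere the series of c_k L_{k+n}(x), where c_k are
   the coefficients of f, and it suffices to bound L_k(x) + ... + L_{k+N-1}(x) by C(x) sqrt N
   uniformly in k. Energy estimates for the Laguerre equation give |L_n(x)| = O(n^(-1/4)) and
   |L_n'(x)| = O(n^(1/4)) at every x > 0; the sum equals L_k'(x) - L_{k+N}'(x), which settles
   k <= N^2, and for larger k it is at most N times the largest term. No logarithm is lost.

   That f agrees with its Laguerre series almost everywhere is proved by testing against exp(-m x):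
   the remainder of its Laguerre expansion is (m/(1+m))^N T^N applied to it, which tends to 0
   because T is a contraction. Polynomials in exp(-x) then separate functions by Weierstrass. *)

theory Submission
  imports Defs "HOL-Probability.Distributions"
begin

section \<open>Pointwise bounds for Laguerre polynomials\<close>

text \<open>Only summability of the coefficients is available, so sums of consecutive Laguerre
  polynomials have to be bounded uniformly in the starting index. The threshold \<open>N^2\<close>
  comes from the exponents: at index \<open>n = N^2\<close> both \<open>n^(1/4)\<close> and
  \<open>N * n^(-1/4)\<close> equal \<open>sqrt N\<close>.

  Reaching these exponents is the main obstacle. The natural energy
  \<open>n * L^2 + x * L'^2\<close> equals \<open>n\<close> at 0, and a Gronwall argument alone
  keeps it of order \<open>n\<close>, which shows only that \<open>L\<close> is bounded. The missing
  factor \<open>sqrt n\<close> is a decay of the energy like \<open>x^(-1/2)\<close> from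
  \<open>x = 1/n\<close> on, which occurs because its two summands balance on average. A cross term
  makes the balance exact up to an error that can be integrated.

  A second difficulty is that the iterates act on a representative, which agrees with its series
  only off a null set, while one null set must serve all iterates. It does, because the operator
  leaves the pointwise difference between \<open>f\<close> and its series unchanged.\<close>

definition laguerre' :: "nat \<Rightarrow> real \<Rightarrow> real" where
  "laguerre' n x = - (\<Sum>j<n. laguerre j x)"

section \<open>Derivative identities and the Laguerre differential equation\<close>

lemma laguerre_0 [simp]: "laguerre 0 x = 1"
  by (simp add: laguerre_eq_sum)

lemma laguerre_at_0 [simp]: "laguerre n 0 = 1"
proof -
  have "laguerre n 0 = (\<Sum>k\<le>n. if k = 0 then 1 else 0)"
    unfolding laguerre_eq_sum by (intro sum.cong) auto
  then show ?thesis by simp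
qed

text \<open>Pascal's rule. The right-hand side is minus the primitive of \<open>laguerre n\<close>
  that vanishes at 0, which is how the operator comes to shift the index.\<close>

lemma laguerre_Suc_diff:
  "laguerre (Suc n) x - laguerre n x =
     (\<Sum>k\<le>n. of_nat (n choose k) * ((- 1) ^ Suc k / fact (Suc k)) * x ^ Suc k)"
proof -
  have "laguerre n x = (\<Sum>k\<le>Suc n. of_nat (n choose k) * ((- 1) ^ k / fact k) * x ^ k)"
    by (simp add: laguerre_eq_sum)
  then have "laguerre (Suc n) x - laguerre n x =
      (\<Sum>k\<le>Suc n. (of_nat (Suc n choose k) - of_nat (n choose k)) * ((- 1) ^ k / fact k) * x ^ k)"
    by (simp only: laguerre_eq_sum [of "Suc n"] sum_subtractf [symmetric] left_diff_distrib)
  also have "\<dots> = (\<Sum>k\<le>n. of_nat (n choose k) * ((- 1) ^ Suc k / fact (Suc k)) * x ^ Suc k)"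
    by (subst sum.atMost_Suc_shift) simp
  finally show ?thesis .
qed

text \<open>Differentiating \<open>laguerre_Suc_diff\<close> termwise gives
  \<open>- laguerre n\<close>, so the derivative accumulates the lower polynomials. Taking that sum
  as the definition of \<open>laguerre'\<close> makes later sums over consecutive indices telescope
  at once.\<close>

lemma has_real_derivative_laguerre:
  "(laguerre n has_real_derivative laguerre' n x) (at x)"
proof (induction n)
  case 0
  have "laguerre 0 = (\<lambda>_. 1)" by auto
  then show ?case by (simp add: laguerre'_def)
next
  case (Suc n)
  have eq: "laguerre (Suc n) = (\<lambda>x. laguerre n x +
      (\<Sum>k\<le>n. of_nat (n choose k) * ((- 1) ^ Suc k / fact (Suc k)) * x ^ Suc k))"
    using laguerre_Suc_diff [of n] by (auto simp: algebra_simps fun_eq_iff)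
  have "((\<lambda>x. of_nat (n choose k) * ((- 1) ^ Suc k / fact (Suc k)) * x ^ Suc k)
      has_real_derivative - (of_nat (n choose k) * ((- 1) ^ k / fact k) * x ^ k)) (at x)" for k
  proof -
    have "(of_nat (n choose k) * ((- 1) ^ Suc k / fact (Suc k))) * (real (Suc k) * x ^ k) =
        - (of_nat (n choose k) * ((- 1) ^ k / fact k) * x ^ k)"
      by (simp add: field_simps del: of_nat_Suc)
    moreover have "((\<lambda>x::real. x ^ Suc k) has_real_derivative real (Suc k) * x ^ k) (at x)"
      using DERIV_pow [of "Suc k" x UNIV] by simp
    ultimately show ?thesis
      using DERIV_cmult by metis
  qed
  then have "(laguerre (Suc n) has_real_derivative (laguerre' n x +
      (\<Sum>k\<le>n. - (of_nat (n choose k) * ((- 1) ^ k / fact k) * x ^ k)))) (at x)"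
    unfolding eq by (intro DERIV_add Suc DERIV_sum)
  then show ?case
    by (simp add: laguerre'_def sum_negf laguerre_eq_sum [of n])
qed

lemmas laguerre_derivs [derivative_intros] = has_real_derivative_laguerre [THEN DERIV_chain2]

text \<open>The power rule combined with the absorption identity
  \<open>(k + 1) * (n + 1 choose k + 1) = (n + 1) * (n choose k)\<close>.\<close>

lemma mult_laguerre'_Suc:
  "x * laguerre' (Suc n) x = real (Suc n) * (laguerre (Suc n) x - laguerre n x)"
proof -
  have "(laguerre (Suc n) has_real_derivative
      (\<Sum>k\<le>Suc n. of_nat (Suc n choose k) * ((- 1) ^ k / fact k) * (real k * x ^ (k - 1)))) (at x)"
    unfolding laguerre_eq_sum [abs_def]
    by (intro DERIV_sum DERIV_cmult) (use DERIV_pow in auto)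
  then have "x * laguerre' (Suc n) x =
      x * (\<Sum>k\<le>Suc n. of_nat (Suc n choose k) * ((- 1) ^ k / fact k) * (real k * x ^ (k - 1)))"
    using DERIV_unique has_real_derivative_laguerre by metis
  also have "\<dots> = (\<Sum>k\<le>n. x * (of_nat (Suc n choose Suc k) * ((- 1) ^ Suc k / fact (Suc k)) *
      (real (Suc k) * x ^ k)))"
    by (subst sum.atMost_Suc_shift) (simp add: sum_distrib_left del: fact_Suc)
  also have "\<dots> = (\<Sum>k\<le>n. real (Suc n) *
      (of_nat (n choose k) * ((- 1) ^ Suc k / fact (Suc k)) * x ^ Suc k))"
  proof (intro sum.cong refl)
    fix k
    have "real (Suc k) * real (Suc n choose Suc k) = real (Suc n) * real (n choose k)"
      using Suc_times_binomial_eq [of n k] by (metis mult.commute of_nat_mult)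
    then have "((- 1) ^ Suc k / fact (Suc k)) * x * x ^ k * (real (Suc k) * real (Suc n choose Suc k)) =
        ((- 1) ^ Suc k / fact (Suc k)) * x * x ^ k * (real (Suc n) * real (n choose k))"
      by (rule arg_cong)
    then show "x * (of_nat (Suc n choose Suc k) * ((- 1) ^ Suc k / fact (Suc k)) * (real (Suc k) * x ^ k)) =
        real (Suc n) * (of_nat (n choose k) * ((- 1) ^ Suc k / fact (Suc k)) * x ^ Suc k)"
      by (simp only: power_Suc [of x] mult_ac)
  qed
  also have "\<dots> = real (Suc n) * (laguerre (Suc n) x - laguerre n x)"
    unfolding laguerre_Suc_diff sum_distrib_left ..
  finally show ?thesis .
qed

text \<open>Comes from differentiating \<open>mult_laguerre'_Suc\<close>. The second derivative is
  described through \<open>x * d\<close> only, so that nothing is divided by \<open>x\<close> and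
  the point 0 is included.\<close>

lemma laguerre_ode:
  obtains d where "(laguerre' n has_real_derivative d) (at x)"
    and "x * d = (x - 1) * laguerre' n x - real n * laguerre n x"
proof -
  define d where "d = - (\<Sum>j<n. laguerre' j x)"
  have d: "(laguerre' n has_real_derivative d) (at x)"
    unfolding laguerre'_def [where n = n, abs_def] d_def
    by (intro DERIV_minus DERIV_sum has_real_derivative_laguerre)
  have "x * d = (x - 1) * laguerre' n x - real n * laguerre n x"
  proof (cases n)
    case 0
    then show ?thesis by (simp add: d_def laguerre'_def)
  next
    case (Suc m)
    have "((\<lambda>x. x * laguerre' n x) has_real_derivative laguerre' n x + x * d) (at x)"
      by (auto intro!: derivative_eq_intros d)
    moreover have "((\<lambda>x. x * laguerre' n x) has_real_derivative
        real n * (laguerre' n x - laguerre' m x)) (at x)"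
      unfolding Suc mult_laguerre'_Suc by (auto intro!: derivative_eq_intros)
    ultimately have "laguerre' n x + x * d = real n * (laguerre' n x - laguerre' m x)"
      by (rule DERIV_unique)
    also have "\<dots> = - (real n * laguerre m x)"
      by (simp add: Suc laguerre'_def)
    also have "\<dots> = x * laguerre' n x - real n * laguerre n x"
      using mult_laguerre'_Suc [of x m] by (simp add: Suc algebra_simps)
    finally show ?thesis by (simp add: algebra_simps)
  qed
  with d that show ?thesis by blast
qed

section \<open>Energy estimates\<close>

definition laguerre_energy :: "nat \<Rightarrow> real \<Rightarrow> real" where
  "laguerre_energy n x = real n * (laguerre n x)\<^sup>2 + x * (laguerre' n x)\<^sup>2"

lemma laguerre_energy_nonneg: "x \<ge> 0 \<Longrightarrow> laguerre_energy n x \<ge> 0"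
  by (simp add: laguerre_energy_def)

text \<open>The differential equation makes the terms in \<open>laguerre n x * laguerre' n x\<close>
  cancel.\<close>

lemma laguerre_energy_deriv:
  "(laguerre_energy n has_real_derivative (2 * x - 1) * (laguerre' n x)\<^sup>2) (at x)"
proof -
  obtain d where d: "(laguerre' n has_real_derivative d) (at x)"
    and ode: "x * d = (x - 1) * laguerre' n x - real n * laguerre n x"
    by (rule laguerre_ode)
  have "real n * (2 * laguerre n x * laguerre' n x) + ((laguerre' n x)\<^sup>2 + 2 * laguerre' n x * (x * d)) =
      (2 * x - 1) * (laguerre' n x)\<^sup>2"
    unfolding ode by (simp add: power2_eq_square algebra_simps)
  then show ?thesis
    unfolding laguerre_energy_def [abs_def]
    by (auto intro!: derivative_eq_intros d simp: algebra_simps power2_eq_square)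
qed

text \<open>Gronwall with rate 2: \<open>(2 * x - 1) * L'^2 <= 2 * x * L'^2\<close>, which is at
  most twice the energy, and the energy at 0 is \<open>n\<close>.\<close>

lemma laguerre_energy_le:
  assumes "x \<ge> 0"
  shows "laguerre_energy n x \<le> real n * exp (2 * x)"
proof -
  have "exp (- 2 * x) * laguerre_energy n x \<le> exp (- 2 * 0) * laguerre_energy n 0"
  proof (rule DERIV_nonpos_imp_nonincreasing [OF assms])
    fix t :: real assume "0 \<le> t" "t \<le> x"
    have "((\<lambda>t. exp (- 2 * t) * laguerre_energy n t) has_real_derivative
        - exp (- 2 * t) * (2 * real n * (laguerre n t)\<^sup>2 + (laguerre' n t)\<^sup>2)) (at t)"
      by (rule derivative_eq_intros laguerre_energy_deriv refl | simp)+
        (simp add: laguerre_energy_def algebra_simps)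
    moreover have "- exp (- 2 * t) * (2 * real n * (laguerre n t)\<^sup>2 + (laguerre' n t)\<^sup>2) \<le> 0"
      by (simp add: mult_nonneg_nonneg)
    ultimately show "\<exists>y. ((\<lambda>t. exp (- 2 * t) * laguerre_energy n t) has_real_derivative y) (at t) \<and> y \<le> 0"
      by blast
  qed
  then show ?thesis
    by (simp add: laguerre_energy_def exp_minus field_simps)
qed

text \<open>Uniformity in the index is the point: it makes Laguerre series with absolutely summable
  coefficients converge at every \<open>x >= 0\<close>.\<close>

lemma abs_laguerre_le:
  assumes "x \<ge> 0"
  shows "\<bar>laguerre n x\<bar> \<le> exp x"
proof (cases "n = 0")
  case False
  have "real n * (laguerre n x)\<^sup>2 \<le> laguerre_energy n x"
    using assms by (simp add: laguerre_energy_def)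
  also have "\<dots> \<le> real n * exp (2 * x)"
    by (rule laguerre_energy_le [OF assms])
  finally have "(laguerre n x)\<^sup>2 \<le> (exp x)\<^sup>2"
    using False by (simp add: exp_double)
  then show ?thesis
    by (metis abs_le_square_iff abs_exp_cancel)
qed (use assms in simp)

text \<open>The cross term turns the growth rate of order \<open>1 / x\<close> of \<open>sqrt x * laguerre_energy n x\<close>
  into one that is integrable on \<open>[1 / n, \<infinity>)\<close> uniformly in \<open>n\<close>.\<close>

definition laguerre_energy2 :: "nat \<Rightarrow> real \<Rightarrow> real" where
  "laguerre_energy2 n x = sqrt x * (laguerre_energy n x + laguerre n x * laguerre' n x / 2)"

text \<open>The derivative of \<open>sqrt x * laguerre_energy n x\<close> contains
  \<open>(n * L^2 - x * L'^2) / (2 * sqrt x)\<close>. By the differential equation,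
  \<open>sqrt x / 2\<close> times the derivative of \<open>L * L'\<close> contributes exactly the
  opposite. What survives is a multiple of \<open>L * L'\<close> and a term that is harmless for
  bounded \<open>x\<close>.\<close>

lemma laguerre_energy2_deriv:
  assumes "x > 0"
  shows "(laguerre_energy2 n has_real_derivative
    sqrt x * (2 * x * (laguerre' n x)\<^sup>2 + laguerre n x * laguerre' n x * (1 / 2 - 1 / (4 * x)))) (at x)"
proof -
  obtain d where d: "(laguerre' n has_real_derivative d) (at x)"
    and ode: "x * d = (x - 1) * laguerre' n x - real n * laguerre n x"
    by (rule laguerre_ode)
  define s where "s = sqrt x"
  have s: "s > 0" "x = s\<^sup>2" using assms by (auto simp: s_def)
  have d_eq: "d = ((x - 1) * laguerre' n x - real n * laguerre n x) / x"
    using ode assms by (simp add: field_simps)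
  have "(laguerre_energy2 n has_real_derivative
      inverse s / 2 * (laguerre_energy n x + laguerre n x * laguerre' n x / 2) +
      s * ((2 * x - 1) * (laguerre' n x)\<^sup>2 + ((laguerre' n x)\<^sup>2 + laguerre n x * d) / 2)) (at x)"
    unfolding laguerre_energy2_def [abs_def]
    using assms
    by (auto intro!: derivative_eq_intros laguerre_energy_deriv d simp: s_def algebra_simps power2_eq_square)
  moreover have "inverse s / 2 * (laguerre_energy n x + laguerre n x * laguerre' n x / 2) +
      s * ((2 * x - 1) * (laguerre' n x)\<^sup>2 + ((laguerre' n x)\<^sup>2 + laguerre n x * d) / 2) =
      s * (2 * x * (laguerre' n x)\<^sup>2 + laguerre n x * laguerre' n x * (1 / 2 - 1 / (4 * x)))"
    unfolding d_eq laguerre_energy_def s(2) using s(1) by (simp add: field_simps power2_eq_square)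
  ultimately show ?thesis by (simp add: s_def)
qed

text \<open>Arithmetic-geometric mean inequality for the two summands of the energy. The gain
  \<open>1 / sqrt (n * x)\<close> is what makes the cross term of lower order.\<close>

lemma abs_laguerre_mult_laguerre'_le:
  assumes "x > 0" "n > 0"
  shows "\<bar>laguerre n x * laguerre' n x\<bar> \<le> laguerre_energy n x / (2 * sqrt (real n * x))"
proof -
  have "0 \<le> (sqrt (real n) * \<bar>laguerre n x\<bar> - sqrt x * \<bar>laguerre' n x\<bar>)\<^sup>2" by simp
  then have "2 * (sqrt (real n) * sqrt x) * \<bar>laguerre n x * laguerre' n x\<bar> \<le> laguerre_energy n x"
    using assms by (simp add: power2_diff laguerre_energy_def power_mult_distrib abs_mult mult_ac)
  then show ?thesis using assms by (simp add: field_simps real_sqrt_mult)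
qed

text \<open>For \<open>n * x >= 1\<close> the product \<open>L * L'\<close> is at most half the
  energy, and the cross term carries a further factor \<open>1 / 2\<close>; hence the corrected
  quantity deviates by at most a quarter.\<close>

lemma
  assumes "x > 0" "real n * x \<ge> 1"
  shows laguerre_energy2_ge: "laguerre_energy2 n x \<ge> 3 / 4 * (sqrt x * laguerre_energy n x)"
    and laguerre_energy2_le: "laguerre_energy2 n x \<le> 5 / 4 * (sqrt x * laguerre_energy n x)"
proof -
  have n: "n > 0" using assms by (cases n) auto
  have "sqrt (real n * x) \<ge> 1" using assms by simp
  then have "laguerre_energy n x / (2 * sqrt (real n * x)) \<le> laguerre_energy n x / (2 * 1)"
    using laguerre_energy_nonneg [of x n] assms by (intro divide_left_mono) auto
  then have "\<bar>laguerre n x * laguerre' n x\<bar> \<le> laguerre_energy n x / 2"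
    using abs_laguerre_mult_laguerre'_le [OF assms(1) n] by simp
  then have "sqrt x * \<bar>laguerre n x * laguerre' n x\<bar> \<le> sqrt x * (laguerre_energy n x / 2)"
    using assms by (intro mult_left_mono) auto
  moreover have "\<bar>laguerre_energy2 n x - sqrt x * laguerre_energy n x\<bar> =
      sqrt x * \<bar>laguerre n x * laguerre' n x\<bar> / 2"
    using assms by (simp add: laguerre_energy2_def algebra_simps abs_mult)
  ultimately have "\<bar>laguerre_energy2 n x - sqrt x * laguerre_energy n x\<bar> \<le>
      sqrt x * laguerre_energy n x / 4"
    by simp
  then show "laguerre_energy2 n x \<ge> 3 / 4 * (sqrt x * laguerre_energy n x)"
    and "laguerre_energy2 n x \<le> 5 / 4 * (sqrt x * laguerre_energy n x)"
    by linarith+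
qed

lemma laguerre_energy2_deriv_le:
  assumes "x > 0" "real n * x \<ge> 1"
  shows "sqrt x * (2 * x * (laguerre' n x)\<^sup>2 + laguerre n x * laguerre' n x * (1 / 2 - 1 / (4 * x)))
    \<le> (5 + 1 / (4 * x * sqrt (real n * x))) * laguerre_energy2 n x"
proof -
  have n: "n > 0" using assms by (cases n) auto
  define E where "E = laguerre_energy n x"
  define r where "r = sqrt (real n * x)"
  have r: "r \<ge> 1" using assms by (simp add: r_def)
  have E: "E \<ge> 0" using laguerre_energy_nonneg assms by (simp add: E_def)
  have D: "x * (laguerre' n x)\<^sup>2 \<le> E" by (simp add: E_def laguerre_energy_def)
  have "laguerre n x * laguerre' n x * (1 / 2 - 1 / (4 * x)) \<le>
      \<bar>laguerre n x * laguerre' n x\<bar> * \<bar>1 / 2 - 1 / (4 * x)\<bar>"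
    by (metis abs_ge_self abs_mult)
  also have "\<dots> \<le> E / (2 * r) * (1 / 2 + 1 / (4 * x))"
    using abs_laguerre_mult_laguerre'_le [OF assms(1) n] assms(1) E r
    by (intro mult_mono) (auto simp: E_def r_def abs_le_iff)
  finally have "2 * x * (laguerre' n x)\<^sup>2 + laguerre n x * laguerre' n x * (1 / 2 - 1 / (4 * x))
      \<le> 2 * E + E / (2 * r) * (1 / 2 + 1 / (4 * x))"
    using D by linarith
  also have "\<dots> = E * (2 + 1 / (4 * r) + 1 / (8 * x * r))"
    using r assms(1) by (simp add: field_simps)
  \<comment> \<open>The factor \<open>3 / 4\<close> is split off so that
    \<open>laguerre_energy2_ge\<close> can trade the energy for \<open>laguerre_energy2\<close>. The
    constant \<open>5\<close> is generous: \<open>3 / 4 * 5\<close> only has to exceed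
    \<open>2 + 1 / 4\<close>.\<close>
  also have "\<dots> \<le> E * (3 / 4 * (5 + 1 / (4 * x * r)))"
  proof (intro mult_left_mono E)
    have "1 / (4 * r) \<le> 1 / 4" using r by (simp add: field_simps)
    moreover have "1 / (8 * x * r) \<le> 3 / 4 * (1 / (4 * x * r))"
      using r assms(1) by (simp add: field_simps)
    ultimately show "2 + 1 / (4 * r) + 1 / (8 * x * r) \<le> 3 / 4 * (5 + 1 / (4 * x * r))"
      by (simp add: distrib_left)
  qed
  finally have "sqrt x * (2 * x * (laguerre' n x)\<^sup>2 + laguerre n x * laguerre' n x * (1 / 2 - 1 / (4 * x)))
      \<le> sqrt x * (E * (3 / 4 * (5 + 1 / (4 * x * r))))"
    using assms(1) by (intro mult_left_mono) auto
  also have "\<dots> = (5 + 1 / (4 * x * r)) * (3 / 4 * (sqrt x * E))"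
    by (simp only: mult_ac)
  also have "\<dots> \<le> (5 + 1 / (4 * x * r)) * laguerre_energy2 n x"
    using laguerre_energy2_ge [OF assms] r assms(1)
    by (intro mult_left_mono) (auto simp: E_def)
  finally show ?thesis by (simp add: r_def)
qed

lemma laguerre_energy_le_sqrt_aux:
  assumes "x > 0" "real n * x \<ge> 1"
  shows "laguerre_energy n x \<le> 5 / 3 * (exp (5 * x) * exp (5 / 2)) / sqrt x * sqrt (real n)"
proof -
  have n: "n > 0" using assms by (cases n) auto
  \<comment> \<open>At \<open>1 / n\<close> the crude energy bound is already good enough, since
    \<open>sqrt a * n = sqrt n\<close>.\<close>
  define a where "a = 1 / real n"
  have a: "a > 0" "a \<le> x" "real n * a = 1" "a \<le> 1"
    using n assms by (auto simp: a_def field_simps)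
  \<comment> \<open>\<open>- G\<close> is an antiderivative of the growth rate in
    \<open>laguerre_energy2_deriv_le\<close>, so \<open>exp (G t)\<close> is the integrating factor.
    Its singular part equals \<open>1 / 2\<close> at \<open>a\<close> whatever \<open>n\<close>
    is.\<close>
  define G where "G t = 1 / (2 * sqrt (real n) * sqrt t) - 5 * t" for t
  have "exp (G x) * laguerre_energy2 n x \<le> exp (G a) * laguerre_energy2 n a"
  proof (rule DERIV_nonpos_imp_nonincreasing [OF a(2)])
    fix t assume "a \<le> t" "t \<le> x"
    then have t: "t > 0" using a by simp
    have nt: "real n * t \<ge> 1"
      using \<open>a \<le> t\<close> a(3) n by (metis mult_le_cancel_left_pos of_nat_0_less_iff)
    have G': "(G has_real_derivative - (5 + 1 / (4 * t * sqrt (real n * t)))) (at t)"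
      unfolding G_def [abs_def] using t n
      by (auto intro!: derivative_eq_intros simp: real_sqrt_mult field_simps power2_eq_square)
    define K where "K = 5 + 1 / (4 * t * sqrt (real n * t))"
    let ?d = "sqrt t * (2 * t * (laguerre' n t)\<^sup>2 + laguerre n t * laguerre' n t * (1 / 2 - 1 / (4 * t)))"
    have "((\<lambda>t. exp (G t) * laguerre_energy2 n t) has_real_derivative
        exp (G t) * (?d - K * laguerre_energy2 n t)) (at t)"
      by (rule derivative_eq_intros G' [folded K_def] laguerre_energy2_deriv [OF t] refl)+
        (simp add: algebra_simps)
    moreover have "exp (G t) * (?d - K * laguerre_energy2 n t) \<le> 0"
      using laguerre_energy2_deriv_le [OF t nt, folded K_def] by (intro mult_nonneg_nonpos) auto
    ultimately show "\<exists>y. ((\<lambda>t. exp (G t) * laguerre_energy2 n t) has_real_derivative y) (at t) \<and> y \<le> 0"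
      by blast
  qed
  also have "\<dots> \<le> exp (1 / 2) * (5 / 4 * (exp 2 * sqrt (real n)))"
  proof (intro mult_mono)
    have "sqrt (real n) * sqrt a = 1" using a by (metis real_sqrt_mult real_sqrt_one)
    then show "exp (G a) \<le> exp (1 / 2)" using a by (simp add: G_def mult.assoc)
    have "laguerre_energy2 n a \<le> 5 / 4 * (sqrt a * laguerre_energy n a)"
      using a by (intro laguerre_energy2_le) auto
    also have "sqrt a * laguerre_energy n a \<le> sqrt a * (real n * exp (2 * a))"
      using laguerre_energy_le [of a n] a by (intro mult_left_mono) auto
    also have "\<dots> \<le> sqrt a * (real n * exp 2)"
      using a by (intro mult_left_mono) auto
    also have "\<dots> = sqrt (real n) * sqrt a * (sqrt (real n) * exp 2)"
      by simp
    also have "\<dots> = exp 2 * sqrt (real n)"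
      unfolding \<open>sqrt (real n) * sqrt a = 1\<close> by simp
    finally show "laguerre_energy2 n a \<le> 5 / 4 * (exp 2 * sqrt (real n))" by simp
    show "0 \<le> laguerre_energy2 n a"
      using laguerre_energy_nonneg [of a n] a
      by (intro order.trans [OF _ laguerre_energy2_ge]) auto
  qed auto
  also have "\<dots> = 5 / 4 * exp (5 / 2) * sqrt (real n)"
    using exp_add [of "1 / 2" "2 :: real"] by simp
  finally have 1: "exp (G x) * laguerre_energy2 n x \<le> 5 / 4 * exp (5 / 2) * sqrt (real n)" .
  have "exp (- 5 * x) * (3 / 4 * (sqrt x * laguerre_energy n x)) \<le> exp (G x) * laguerre_energy2 n x"
    using laguerre_energy2_ge [OF assms] laguerre_energy_nonneg [of x n] assms
    by (intro mult_mono) (auto simp: G_def)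
  from this 1 have "exp (- 5 * x) * (3 / 4 * (sqrt x * laguerre_energy n x)) \<le> 5 / 4 * exp (5 / 2) * sqrt (real n)"
    by (rule order.trans)
  then have "exp (5 * x) * (exp (- 5 * x) * (3 / 4 * (sqrt x * laguerre_energy n x))) \<le>
      exp (5 * x) * (5 / 4 * exp (5 / 2) * sqrt (real n))"
    by (rule mult_left_mono) auto
  then have "3 / 4 * (sqrt x * laguerre_energy n x) \<le>
      exp (5 * x) * (5 / 4 * exp (5 / 2) * sqrt (real n))"
    by (simp add: mult.assoc [symmetric] mult_exp_exp)
  then show ?thesis
    using assms(1) by (simp add: field_simps)
qed

lemma laguerre_energy_le_sqrt:
  assumes "x > 0"
  obtains C where "C \<ge> 0" "\<And>n. laguerre_energy n x \<le> C * sqrt (real n)"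
proof -
  define C1 where "C1 = 5 / 3 * (exp (5 * x) * exp (5 / 2)) / sqrt x"
  define C2 where "C2 = exp (2 * x) / sqrt x"
  have C: "C1 \<ge> 0" "C2 \<ge> 0" using assms by (auto simp: C1_def C2_def)
  have "laguerre_energy n x \<le> (C1 + C2) * sqrt (real n)" for n
  proof (cases "real n * x \<ge> 1")
    case True
    then have "laguerre_energy n x \<le> C1 * sqrt (real n)"
      unfolding C1_def by (rule laguerre_energy_le_sqrt_aux [OF assms])
    also have "\<dots> \<le> (C1 + C2) * sqrt (real n)"
      using C by (intro mult_right_mono) auto
    finally show ?thesis .
  next
    \<comment> \<open>Here \<open>sqrt n\<close> is at most \<open>1 / sqrt x\<close>, so the crude
      bound of order \<open>n\<close> is itself of order \<open>sqrt n\<close>.\<close>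
    case False
    then have "sqrt (real n) * sqrt x \<le> 1"
      using real_sqrt_le_mono [of "real n * x" 1] by (simp add: real_sqrt_mult)
    then have "sqrt (real n) * (sqrt (real n) * sqrt x) \<le> sqrt (real n) * 1"
      by (intro mult_left_mono) auto
    then have "real n \<le> sqrt (real n) / sqrt x"
      using assms by (simp add: field_simps)
    then have "real n * exp (2 * x) \<le> sqrt (real n) / sqrt x * exp (2 * x)"
      by (intro mult_right_mono) auto
    also have "\<dots> = C2 * sqrt (real n)" by (simp add: C2_def)
    also have "\<dots> \<le> (C1 + C2) * sqrt (real n)"
      using C by (intro mult_right_mono) auto
    finally show ?thesis
      using laguerre_energy_le [of x n] assms by simp
  qed
  with C that show ?thesis by (metis add_nonneg_nonneg)
qed

section \<open>Sums of Laguerre polynomials over consecutive indices\<close>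

lemma abs_sum_laguerre_le:
  assumes "x > 0"
  obtains C where "\<And>k N. \<bar>\<Sum>n<N. laguerre (k + n) x\<bar> \<le> C * sqrt (real N)"
proof -
  obtain C where C: "C \<ge> 0" "\<And>n. laguerre_energy n x \<le> C * sqrt (real n)"
    using laguerre_energy_le_sqrt [OF assms] by blast
  have "\<bar>\<Sum>n<N. laguerre (k + n) x\<bar> \<le> (sqrt C + 4 * sqrt (C / x)) * sqrt (real N)" if "N > 0" for k N
  proof (cases "k \<le> N\<^sup>2")
    case True
    have D: "\<bar>laguerre' n x\<bar> \<le> sqrt (C / x) * (2 * sqrt (real N))" if "n \<le> k + N" for n
    proof -
      have "N \<le> N\<^sup>2" using \<open>N > 0\<close> by (simp add: power2_eq_square)
      \<comment> \<open>Both \<open>k\<close> and \<open>k + N\<close> are at most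
        \<open>2 * N^2\<close>; the larger bound \<open>4 * N^2\<close> is a perfect square, which
        keeps the root simple.\<close>
      then have "n \<le> 4 * N\<^sup>2" using that True by simp
      then have "real n \<le> real (4 * N\<^sup>2)" by (simp only: of_nat_le_iff)
      then have "real n \<le> (2 * real N)\<^sup>2" by (simp add: power_mult_distrib)
      then have "sqrt (real n) \<le> 2 * real N" by (simp add: real_le_lsqrt)
      then have "C * sqrt (real n) \<le> C * (2 * real N)"
        using C(1) by (intro mult_left_mono) auto
      moreover have "x * (laguerre' n x)\<^sup>2 \<le> laguerre_energy n x"
        by (simp add: laguerre_energy_def)
      ultimately have "(laguerre' n x)\<^sup>2 \<le> C / x * (2 * real N)"
        using C(2) [of n] assms by (simp add: field_simps)
      then have "\<bar>laguerre' n x\<bar> \<le> sqrt (C / x) * sqrt (2 * real N)"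
        by (metis real_sqrt_abs real_sqrt_le_iff real_sqrt_mult)
      also have "\<dots> \<le> sqrt (C / x) * (2 * sqrt (real N))"
        using C(1) assms by (intro mult_left_mono) (auto simp: real_sqrt_mult intro!: mult_right_mono real_le_lsqrt)
      finally show ?thesis .
    qed
    have "(\<Sum>n<N. laguerre (k + n) x) = laguerre' k x - laguerre' (k + N) x"
      by (induction N) (auto simp: laguerre'_def)
    then have "\<bar>\<Sum>n<N. laguerre (k + n) x\<bar> \<le> 4 * sqrt (C / x) * sqrt (real N)"
      using D [of k] D [of "k + N"] by simp
    also have "\<dots> \<le> (sqrt C + 4 * sqrt (C / x)) * sqrt (real N)"
      using C by (intro mult_right_mono) auto
    finally show ?thesis .
  next
    case False
    \<comment> \<open>Dividing the energy bound by \<open>s = sqrt (k + n)\<close> leaves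
      \<open>s * L^2 <= C\<close>, and \<open>s >= N\<close> because the index lies beyond
      \<open>N^2\<close>.\<close>
    have L: "\<bar>laguerre (k + n) x\<bar> \<le> sqrt C / sqrt (real N)" for n
    proof -
      have "N\<^sup>2 \<le> k + n" using False by simp
      then have "(real N)\<^sup>2 \<le> real (k + n)" by (metis of_nat_le_iff of_nat_power)
      then have N: "real N \<le> sqrt (real (k + n))" by (simp add: real_le_rsqrt)
      define s where "s = sqrt (real (k + n))"
      have s: "s > 0" "real (k + n) = s * s" "real N \<le> s"
        using less_le_trans [of 0 "real N", OF _ N] N that
        by (simp_all add: s_def del: of_nat_add)
      have "s * s * (laguerre (k + n) x)\<^sup>2 \<le> laguerre_energy (k + n) x"
        using assms unfolding laguerre_energy_def s(2) by simp
      also have "\<dots> \<le> C * s" using C(2) [of "k + n"] by (simp add: s_def)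
      finally have "s * (laguerre (k + n) x)\<^sup>2 \<le> C"
        using s(1) by (simp add: mult.assoc mult.commute [of C])
      moreover have "real N * (laguerre (k + n) x)\<^sup>2 \<le> s * (laguerre (k + n) x)\<^sup>2"
        using s(3) by (intro mult_right_mono) auto
      ultimately have "(laguerre (k + n) x)\<^sup>2 \<le> C / real N"
        using that by (simp add: field_simps)
      then show ?thesis
        by (metis real_sqrt_abs real_sqrt_le_iff real_sqrt_divide)
    qed
    have "\<bar>\<Sum>n<N. laguerre (k + n) x\<bar> \<le> (\<Sum>n<N. \<bar>laguerre (k + n) x\<bar>)" by (rule sum_abs)
    also have "\<dots> \<le> real (card {..<N}) * (sqrt C / sqrt (real N))"
      by (rule sum_bounded_above) (rule L)
    also have "\<dots> = sqrt C * sqrt (real N)"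
      using that by (simp add: field_simps)
    also have "\<dots> \<le> (sqrt C + 4 * sqrt (C / x)) * sqrt (real N)"
      using C assms by (intro mult_right_mono) auto
    finally show ?thesis .
  qed
  then have "\<bar>\<Sum>n<N. laguerre (k + n) x\<bar> \<le> (sqrt C + 4 * sqrt (C / x)) * sqrt (real N)" for k N
    by (cases "N = 0") auto
  with that show ?thesis by blast
qed

section \<open>Uniqueness for Laplace transforms at the natural numbers\<close>

lemma space_exp_weight [simp]: "space exp_weight = {0..}"
  by (simp add: exp_weight_def)

lemma sets_exp_weight [measurable_cong]: "sets exp_weight = sets (lebesgue_on {0..})"
  by (simp add: exp_weight_def)

lemma borel_measurable_exp_weight:
  "g \<in> borel_measurable borel \<Longrightarrow> g \<in> borel_measurable exp_weight"
  by (simp add: measurable_cong_sets [OF sets_exp_weight refl] measurable_completion measurable_restrict_space1)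

lemma borel_measurable_exp_lebesgue_on [measurable]:
  "(\<lambda>x::real. exp (- x)) \<in> borel_measurable (lebesgue_on {0..})"
  by (intro measurable_restrict_space1 measurable_completion) simp

lemma AE_exp_weight_iff: "(AE x in exp_weight. P x) \<longleftrightarrow> (AE x in lebesgue_on {0..}. P x)"
  unfolding exp_weight_def by (subst AE_density) auto

lemma nn_integral_exp_weight:
  assumes [measurable]: "g \<in> borel_measurable borel"
  shows "(\<integral>\<^sup>+x. g x \<partial>exp_weight) = (\<integral>\<^sup>+x. ennreal (exp (- x)) * g x * indicator {0..} x \<partial>lborel)"
proof -
  have g: "g \<in> borel_measurable (lebesgue_on {0..})"
    by (intro measurable_restrict_space1 measurable_completion) simp
  have "(\<integral>\<^sup>+x. g x \<partial>exp_weight) = (\<integral>\<^sup>+x. ennreal (exp (- x)) * g x \<partial>lebesgue_on {0..})"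
    unfolding exp_weight_def using g by (subst nn_integral_density) auto
  also have "\<dots> = (\<integral>\<^sup>+x. ennreal (exp (- x)) * g x * indicator {0..} x \<partial>lebesgue)"
    by (subst nn_integral_restrict_space) auto
  finally show ?thesis by (simp add: nn_integral_completion)
qed

text \<open>Together with the weight, the exponential is \<open>1 / (1 + m)\<close> times the
  exponential density of rate \<open>1 + m\<close>, written as \<open>erlang_density 0\<close>,
  whose moments are known.\<close>

lemma has_bochner_integral_exp_weight_moment:
  assumes "m \<ge> 0"
  shows "has_bochner_integral exp_weight (\<lambda>x. x ^ j * exp (- (m * x))) (fact j / (1 + m) ^ Suc j)"
proof (rule has_bochner_integral_nn_integral)
  show "(\<lambda>x. x ^ j * exp (- (m * x))) \<in> borel_measurable exp_weight"
    by (rule borel_measurable_exp_weight) simp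
  show "AE x in exp_weight. 0 \<le> x ^ j * exp (- (m * x))"
    by (rule AE_I2) simp
  show "0 \<le> fact j / (1 + m) ^ Suc j" using assms by simp
  have "(\<integral>\<^sup>+x. ennreal (x ^ j * exp (- (m * x))) \<partial>exp_weight) =
      (\<integral>\<^sup>+x. ennreal (1 / (1 + m)) * ennreal (erlang_density 0 (1 + m) x * x ^ j) \<partial>lborel)"
  proof (subst nn_integral_exp_weight, simp, intro nn_integral_cong)
    fix x
    have "exp (- x) * exp (- (m * x)) = exp (- (1 + m) * x)"
      by (simp add: mult_exp_exp left_diff_distrib)
    then have "exp (- x) * (x ^ j * exp (- (m * x))) = 1 / (1 + m) * ((1 + m) * exp (- (1 + m) * x) * x ^ j)"
      using assms by simp
    then show "ennreal (exp (- x)) * ennreal (x ^ j * exp (- (m * x))) * indicator {0..} x =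
        ennreal (1 / (1 + m)) * ennreal (erlang_density 0 (1 + m) x * x ^ j)"
      using assms
      by (cases "x < 0") (simp_all add: erlang_density_def ennreal_mult' [symmetric] del: minus_add_distrib)
  qed
  also have "\<dots> = ennreal (1 / (1 + m)) * ennreal (fact j / (1 + m) ^ j)"
    using assms by (subst nn_integral_cmult) (auto simp: nn_integral_erlang_ith_moment)
  also have "\<dots> = ennreal (fact j / (1 + m) ^ Suc j)"
    using assms by (simp add: ennreal_mult' [symmetric])
  finally show "(\<integral>\<^sup>+x. ennreal (x ^ j * exp (- (m * x))) \<partial>exp_weight) = ennreal (fact j / (1 + m) ^ Suc j)" .
qed

lemma nn_integral_exp_weight_1: "(\<integral>\<^sup>+x. 1 \<partial>exp_weight) = 1"
proof -
  have "(\<integral>\<^sup>+x. ennreal (x ^ 0 * exp (- (0 * x))) \<partial>exp_weight) = ennreal (fact 0 / (1 + 0) ^ Suc 0)"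
    using has_bochner_integral_exp_weight_moment [of 0 0]
    by (subst nn_integral_eq_integral) (auto simp: has_bochner_integral_iff)
  then show ?thesis by simp
qed

section \<open>Functions with vanishing exponential moments\<close>

lemma exp_weight_moment_unique_interval:
  fixes r :: "real \<Rightarrow> real"
  assumes r: "integrable exp_weight r"
    and zero: "\<And>i. (LINT x|exp_weight. r x * exp (- x) ^ i) = 0"
  shows "(LINT x|exp_weight. r x * indicator {..a} x) = 0"
proof -
  have rm [measurable]: "r \<in> borel_measurable exp_weight" using r by simp
  have em [measurable]: "(\<lambda>x. exp (- x)) \<in> borel_measurable exp_weight"
    by (rule borel_measurable_exp_weight) simp
  have int: "integrable exp_weight (\<lambda>x. r x * \<phi> (exp (- x)))"
    if "continuous_on UNIV \<phi>" "\<And>u. u \<in> {0..1} \<Longrightarrow> \<bar>\<phi> u\<bar> \<le> B" for \<phi> B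
  proof (rule Bochner_Integration.integrable_bound [of _ "\<lambda>x. B * r x"])
    show "(\<lambda>x. r x * \<phi> (exp (- x))) \<in> borel_measurable exp_weight"
      using borel_measurable_continuous_onI [OF that(1)] by measurable
    show "AE x in exp_weight. norm (r x * \<phi> (exp (- x))) \<le> norm (B * r x)"
    proof (rule AE_I2)
      fix x assume "x \<in> space exp_weight"
      then have "\<bar>\<phi> (exp (- x))\<bar> \<le> B" by (intro that) auto
      then have "\<bar>r x\<bar> * \<bar>\<phi> (exp (- x))\<bar> \<le> \<bar>r x\<bar> * \<bar>B\<bar>" by (intro mult_left_mono) auto
      then show "norm (r x * \<phi> (exp (- x))) \<le> norm (B * r x)"
        by (simp add: abs_mult mult.commute)
    qed
  qed (use r in simp)
  have poly: "(LINT x|exp_weight. r x * p (exp (- x))) = 0" if p0: "real_polynomial_function p" for p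
  proof -
    obtain b n where p: "p = (\<lambda>x. \<Sum>i\<le>n. b i * x ^ i)"
      using p0 unfolding real_polynomial_function_iff_sum by blast
    have "integrable exp_weight (\<lambda>x. r x * exp (- x) ^ i)" for i
      using int [of "\<lambda>u. u ^ i" 1] continuous_on_power [OF continuous_on_id] by (auto simp: power_le_one)
    then have "(LINT x|exp_weight. (\<Sum>i\<le>n. b i * (r x * exp (- x) ^ i))) = 0"
      using zero by (subst Bochner_Integration.integral_sum) auto
    then show ?thesis by (simp add: p sum_distrib_left mult_ac)
  qed
  have cont: "(LINT x|exp_weight. r x * \<phi> (exp (- x))) = 0" if \<phi>: "continuous_on UNIV \<phi>" for \<phi>
  proof -
    define I where "I = (LINT x|exp_weight. r x * \<phi> (exp (- x)))"
    have bdd: "\<exists>B. \<forall>u\<in>{0..1}. \<bar>\<psi> u\<bar> \<le> B" if "continuous_on UNIV \<psi>" for \<psi> :: "real \<Rightarrow> real"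
      using compact_imp_bounded [OF compact_continuous_image [of "{0..1}" \<psi>]]
        continuous_on_subset [OF that, of "{0..1}"] by (auto simp: bounded_iff)
    have *: "\<bar>I\<bar> \<le> e * (LINT x|exp_weight. \<bar>r x\<bar>)" if "e > 0" for e
    proof -
      obtain p where p: "real_polynomial_function p" "\<And>u. u \<in> {0..1} \<Longrightarrow> \<bar>\<phi> u - p u\<bar> < e"
        using Stone_Weierstrass_real_polynomial_function [of "{0..1::real}" \<phi> e]
          continuous_on_subset [OF \<phi>] \<open>e > 0\<close> by auto
      have pc: "continuous_on UNIV p"
        using p(1) by (simp add: continuous_on_polymonial_function real_polynomial_function_eq)
      obtain B where B: "\<forall>u\<in>{0..1}. \<bar>\<phi> u\<bar> \<le> B" using bdd [OF \<phi>] by blast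
      obtain B' where B': "\<forall>u\<in>{0..1}. \<bar>p u\<bar> \<le> B'" using bdd [OF pc] by blast
      have i1: "integrable exp_weight (\<lambda>x. r x * \<phi> (exp (- x)))" using int [OF \<phi>] B by blast
      have i2: "integrable exp_weight (\<lambda>x. r x * p (exp (- x)))" using int [OF pc] B' by blast
      have "I = (LINT x|exp_weight. r x * \<phi> (exp (- x)) - r x * p (exp (- x)))"
        using i1 i2 poly [OF p(1)] by (simp add: I_def)
      also have "\<bar>\<dots>\<bar> \<le> (LINT x|exp_weight. e * \<bar>r x\<bar>)"
      proof (rule order.trans [OF integral_abs_bound integral_mono_AE])
        show "AE x in exp_weight. \<bar>r x * \<phi> (exp (- x)) - r x * p (exp (- x))\<bar> \<le> e * \<bar>r x\<bar>"
        proof (rule AE_I2)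
          fix x assume "x \<in> space exp_weight"
          then have "\<bar>\<phi> (exp (- x)) - p (exp (- x))\<bar> \<le> e" by (intro less_imp_le p) auto
          then have "\<bar>\<phi> (exp (- x)) - p (exp (- x))\<bar> * \<bar>r x\<bar> \<le> e * \<bar>r x\<bar>"
            by (rule mult_right_mono) simp
          then show "\<bar>r x * \<phi> (exp (- x)) - r x * p (exp (- x))\<bar> \<le> e * \<bar>r x\<bar>"
            by (simp add: abs_mult [symmetric] algebra_simps)
        qed
      qed (use r i1 i2 in auto)
      finally show ?thesis by simp
    qed
    have "\<bar>I\<bar> \<le> 0 + e" if "e > 0" for e
    proof -
      \<comment> \<open>Dividing by \<open>J + 1\<close> instead of \<open>J\<close> covers the case
        \<open>J = 0\<close>.\<close>
      define J where "J = (LINT x|exp_weight. \<bar>r x\<bar>)"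
      have J: "J \<ge> 0" by (simp add: J_def)
      have "\<bar>I\<bar> \<le> e / (J + 1) * J"
        using * [of "e / (J + 1)"] J that by (simp add: J_def [symmetric])
      also have "\<dots> \<le> e" using J that by (simp add: field_simps)
      finally show ?thesis by simp
    qed
    then have "\<bar>I\<bar> \<le> 0" by (rule field_le_epsilon)
    then show ?thesis by (simp add: I_def)
  qed
  \<comment> \<open>Ramps equal to 1 for \<open>u >= exp (- a)\<close> and falling to 0 with slope
    \<open>j\<close> to the left of it. Since \<open>exp (- x)\<close> decreases, they converge to
    the indicator of \<open>x <= a\<close> at \<open>u = exp (- x)\<close>.\<close>
  define \<phi> where "\<phi> j u = max 0 (1 - real j * max 0 (exp (- a) - u))" for j u
  have "(\<lambda>j. LINT x|exp_weight. r x * \<phi> j (exp (- x))) \<longlonglongrightarrow> (LINT x|exp_weight. r x * indicator {..a} x)"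
  proof (rule integral_dominated_convergence [where w = "\<lambda>x. \<bar>r x\<bar>"])
    show "(\<lambda>x. r x * indicator {..a} x) \<in> borel_measurable exp_weight"
      by (intro borel_measurable_times rm borel_measurable_exp_weight) simp
    show "(\<lambda>x. r x * \<phi> j (exp (- x))) \<in> borel_measurable exp_weight" for j
      unfolding \<phi>_def by measurable
    show "AE x in exp_weight. (\<lambda>j. r x * \<phi> j (exp (- x))) \<longlonglongrightarrow> r x * indicator {..a} x"
    proof (rule AE_I2, rule tendsto_mult_left)
      fix x :: real
      show "(\<lambda>j. \<phi> j (exp (- x))) \<longlonglongrightarrow> indicator {..a} x"
      proof (cases "x \<le> a")
        case False
        define d where "d = exp (- a) - exp (- x)"
        have d: "d > 0" using False by (simp add: d_def)
        obtain j0 :: nat where j0: "real j0 * d > 1"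
          using reals_Archimedean3 [OF d] by blast
        have "\<phi> j (exp (- x)) = 0" if "j \<ge> j0" for j
        proof -
          have "real j0 * d \<le> real j * d" using that d by (intro mult_right_mono) auto
          then have "1 - real j * d \<le> 0" using j0 by linarith
          then show ?thesis using d by (simp add: \<phi>_def d_def [symmetric])
        qed
        then have "\<forall>\<^sub>F j in sequentially. \<phi> j (exp (- x)) = indicator {..a} x"
          using False by (intro eventually_sequentiallyI [of j0]) auto
        then show ?thesis by (rule tendsto_eventually)
      qed (simp add: \<phi>_def max_def)
    qed
    show "AE x in exp_weight. norm (r x * \<phi> j (exp (- x))) \<le> \<bar>r x\<bar>" for j
    proof (rule AE_I2)
      fix x :: real
      have "\<bar>\<phi> j (exp (- x))\<bar> \<le> 1" by (auto simp: \<phi>_def max_def)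
      then have "\<bar>r x\<bar> * \<bar>\<phi> j (exp (- x))\<bar> \<le> \<bar>r x\<bar> * 1" by (intro mult_left_mono) auto
      then show "norm (r x * \<phi> j (exp (- x))) \<le> \<bar>r x\<bar>" by (simp add: abs_mult)
    qed
  qed (use r in auto)
  moreover have "(LINT x|exp_weight. r x * \<phi> j (exp (- x))) = 0" for j
    unfolding \<phi>_def by (intro cont continuous_intros)
  ultimately show ?thesis by (simp add: LIMSEQ_const_iff)
qed

text \<open>Half-lines form an intersection-stable generator, so the integrals of \<open>r\<close>
  vanish over all Borel sets. A Lebesgue set is an F-sigma set up to a null set, so they vanish over
  every measurable set, and densities are unique.\<close>

lemma exp_weight_moment_unique:
  fixes r :: "real \<Rightarrow> real"
  assumes r: "integrable exp_weight r"
    and zero: "\<And>i. (LINT x|exp_weight. r x * exp (- x) ^ i) = 0"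
  shows "AE x in exp_weight. r x = 0"
proof -
  have rm [measurable]: "r \<in> borel_measurable exp_weight" using r by simp
  have int: "integrable exp_weight (\<lambda>x. r x * indicator A x)" if "A \<in> sets borel" for A
  proof -
    have [measurable]: "indicator A \<in> borel_measurable exp_weight"
      using that by (intro borel_measurable_exp_weight) simp
    show ?thesis
      by (rule Bochner_Integration.integrable_bound [OF r]) (auto split: split_indicator)
  qed
  \<comment> \<open>The zeroth moment; it handles complements in the induction over Borel
    sets.\<close>
  have total: "(LINT x|exp_weight. r x) = 0" using zero [of 0] by simp
  have borel: "(LINT x|exp_weight. r x * indicator A x) = 0" if "A \<in> sets borel" for A
  proof -
    have gen: "sets borel = sigma_sets UNIV (range (\<lambda>a::real. {..a}))"
      by (simp add: borel_eq_atMost)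
    have "Int_stable (range (\<lambda>a::real. {..a}))" by (auto simp: Int_stable_def)
    moreover have "range (\<lambda>a::real. {..a}) \<subseteq> Pow UNIV" by simp
    moreover have "A \<in> sigma_sets UNIV (range (\<lambda>a::real. {..a}))" using that gen by simp
    ultimately show ?thesis
    proof (induction rule: sigma_sets_induct_disjoint)
      case (basic A)
      then show ?case using exp_weight_moment_unique_interval [OF r zero] by auto
    next
      case (compl A)
      then have "A \<in> sets borel" by (simp add: gen)
      then have "(LINT x|exp_weight. r x - r x * indicator A x) = 0"
        using int r total compl by simp
      then show ?case
        by (simp add: indicator_compl right_diff_distrib Compl_eq_Diff_UNIV [symmetric])
    next
      case (union A)
      then have A: "A i \<in> sets borel" for i using gen by auto
      have "(\<lambda>i. LINT x|exp_weight. r x * indicator (\<Union>j<i. A j) x) \<longlonglongrightarrow>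
          (LINT x|exp_weight. r x * indicator (\<Union>j. A j) x)"
      proof (rule integral_dominated_convergence [where w = "\<lambda>x. \<bar>r x\<bar>"])
        show "AE x in exp_weight. (\<lambda>i. r x * indicator (\<Union>j<i. A j) x) \<longlonglongrightarrow> r x * indicator (\<Union>j. A j) x"
          by (rule AE_I2, rule tendsto_mult_left) (rule LIMSEQ_indicator_UN)
        show "(\<lambda>x. r x * indicator (\<Union>j. A j) x) \<in> borel_measurable exp_weight"
          by (rule borel_measurable_integrable, rule int) (use A in auto)
        show "(\<lambda>x. r x * indicator (\<Union>j<i. A j) x) \<in> borel_measurable exp_weight" for i
          by (rule borel_measurable_integrable, rule int) (use A in auto)
      qed (use r in \<open>auto split: split_indicator\<close>)
      moreover have "(LINT x|exp_weight. r x * indicator (\<Union>j<i. A j) x) = 0" for i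
      proof (induction i)
        case (Suc i)
        have "indicator (\<Union>j<Suc i. A j) x = indicator (\<Union>j<i. A j) x + (indicator (A i) x :: real)" for x
        proof -
          have "(\<Union>j<Suc i. A j) = (\<Union>j<i. A j) \<union> A i" by (auto simp: less_Suc_eq)
          moreover have "(\<Union>j<i. A j) \<inter> A i = {}"
          proof -
            have "A j \<inter> A i = {}" if "j < i" for j
              using union(1) that by (simp add: disjoint_family_on_def)
            then show ?thesis by blast
          qed
          ultimately show ?thesis by (simp add: indicator_add [symmetric])
        qed
        moreover have "(\<Union>j<i. A j) \<in> sets borel" using A by auto
        ultimately show ?case
          using Suc union(3) int A by (simp add: distrib_left)
      qed simp
      ultimately show ?case by (simp add: LIMSEQ_const_iff)
    qed simp
  qed
  show ?thesis
  proof (rule density_unique_real [where f' = "\<lambda>_. 0", OF r])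
    fix A assume "A \<in> sets exp_weight"
    then have "A \<in> sets lebesgue" "A \<subseteq> {0..}"
      by (auto simp: sets_exp_weight sets_restrict_space_iff)
    then obtain C T where CT: "fsigma C" "T \<in> null_sets lebesgue" "C \<union> T = A" "disjnt C T"
      by (meson lebesgue_set_almost_fsigma)
    have C: "C \<in> sets borel" using CT(1) by (cases rule: fsigma.cases) auto
    have "AE x in lebesgue. x \<notin> T" using CT(2) by (rule AE_not_in)
    then have "AE x in lebesgue. x \<in> {0..} \<longrightarrow> x \<notin> T"
      by (rule eventually_mono) simp
    then have "AE x in exp_weight. x \<notin> T"
      by (subst AE_exp_weight_iff, subst AE_restrict_space_iff) auto
    moreover have "indicator A x *\<^sub>R r x = r x * indicator C x" if "x \<notin> T" for x
      using that CT(3) [symmetric] by (simp add: indicator_def)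
    ultimately have "AE x in exp_weight. indicator A x *\<^sub>R r x = r x * indicator C x"
      by (rule eventually_mono)
    moreover have "(\<lambda>x. indicator A x *\<^sub>R r x) \<in> borel_measurable exp_weight"
      by (intro borel_measurable_scaleR borel_measurable_indicator rm \<open>A \<in> sets exp_weight\<close>)
    moreover have "(\<lambda>x. r x * indicator C x) \<in> borel_measurable exp_weight"
      using int [OF C] by (rule borel_measurable_integrable)
    ultimately have "(LINT x:A|exp_weight. r x) = (LINT x|exp_weight. r x * indicator C x)"
      unfolding set_lebesgue_integral_def by (intro integral_cong_AE)
    then show "(LINT x:A|exp_weight. r x) = (LINT x:A|exp_weight. 0)"
      by (simp add: borel [OF C])
  qed simp
qed

lemma exp_weight_moment_unique_complex:
  fixes r :: "real \<Rightarrow> complex"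
  assumes r: "integrable exp_weight r"
    and int: "\<And>i. integrable exp_weight (\<lambda>x. r x * of_real (exp (- x) ^ i))"
    and zero: "\<And>i. (LINT x|exp_weight. r x * of_real (exp (- x) ^ i)) = 0"
  shows "AE x in exp_weight. r x = 0"
proof -
  have "AE x in exp_weight. Re (r x) = 0"
  proof (rule exp_weight_moment_unique)
    fix i
    have "(LINT x|exp_weight. Re (r x * of_real (exp (- x) ^ i))) = 0"
      using int zero by (subst integral_Re) auto
    then show "(LINT x|exp_weight. Re (r x) * exp (- x) ^ i) = 0"
      by (simp del: of_real_power of_real_exp)
  qed (use r in auto)
  moreover have "AE x in exp_weight. Im (r x) = 0"
  proof (rule exp_weight_moment_unique)
    fix i
    have "(LINT x|exp_weight. Im (r x * of_real (exp (- x) ^ i))) = 0"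
      using int zero by (subst integral_Im) auto
    then show "(LINT x|exp_weight. Im (r x) * exp (- x) ^ i) = 0"
      by (simp del: of_real_power of_real_exp)
  qed (use r in auto)
  ultimately show ?thesis by eventually_elim (simp add: complex_eq_iff)
qed

section \<open>Expansion in Laguerre polynomials\<close>

lemma borel_measurable_laguerre [measurable]: "laguerre n \<in> borel_measurable borel"
  unfolding laguerre_eq_sum [abs_def] by measurable

lemma continuous_on_laguerre: "continuous_on A (laguerre n)"
  unfolding laguerre_eq_sum [abs_def] by (intro continuous_intros)

text \<open>The operator is a contraction because
  \<open>exp (- x) * ((u x)\<^sup>2 - (u x - U x)\<^sup>2)\<close> is the derivative of \<open>exp (- x) * (U x)\<^sup>2\<close>.\<close>

lemma nn_integral_volterra_contraction:
  fixes u U :: "real \<Rightarrow> real"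
  assumes U: "\<And>x. (U has_real_derivative u x) (at x)" "U 0 = 0" and u: "continuous_on UNIV u"
  shows "(\<integral>\<^sup>+x. ennreal ((u x - U x)\<^sup>2) \<partial>exp_weight) \<le> (\<integral>\<^sup>+x. ennreal ((u x)\<^sup>2) \<partial>exp_weight)"
proof -
  have Uc: "continuous_on UNIV U"
    using U(1) by (meson DERIV_continuous_on has_field_derivative_at_within)
  define v where "v x = exp (- x) * (u x - U x)\<^sup>2" for x
  define w where "w x = exp (- x) * (u x)\<^sup>2" for x
  have vc: "continuous_on UNIV v" and wc: "continuous_on UNIV w"
    unfolding v_def w_def by (intro continuous_intros u Uc)+
  have [measurable]: "v \<in> borel_measurable borel" "w \<in> borel_measurable borel"
      "u \<in> borel_measurable borel" "U \<in> borel_measurable borel"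
    using vc wc u Uc borel_measurable_continuous_onI by auto
  have nn: "v x \<ge> 0" "w x \<ge> 0" for x by (auto simp: v_def w_def)
  have eq: "(\<integral>\<^sup>+x. ennreal ((u x - U x)\<^sup>2) \<partial>exp_weight) = (\<integral>\<^sup>+x. ennreal (v x) * indicator {0..} x \<partial>lborel)"
      "(\<integral>\<^sup>+x. ennreal ((u x)\<^sup>2) \<partial>exp_weight) = (\<integral>\<^sup>+x. ennreal (w x) * indicator {0..} x \<partial>lborel)"
    by (subst nn_integral_exp_weight; simp add: v_def w_def ennreal_mult')+
  have le: "(\<integral>\<^sup>+x. ennreal (v x) * indicator {0..real n} x \<partial>lborel) \<le>
      (\<integral>\<^sup>+x. ennreal (w x) * indicator {0..} x \<partial>lborel)" for n
  proof -
    have iv: "integrable lborel (\<lambda>x. indicator {0..real n} x *\<^sub>R v x)"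
      and iw: "integrable lborel (\<lambda>x. indicator {0..real n} x *\<^sub>R w x)"
      by (intro borel_integrable_compact compact_Icc continuous_on_subset [OF vc]
          continuous_on_subset [OF wc] subset_UNIV)+
    have "(LINT x|lborel. indicator {0..real n} x *\<^sub>R (w x - v x)) =
        exp (- real n) * (U (real n))\<^sup>2 - exp (- 0) * (U 0)\<^sup>2"
    proof (rule integral_FTC_atLeastAtMost)
      show "((\<lambda>x. exp (- x) * (U x)\<^sup>2) has_vector_derivative (w x - v x)) (at x within {0..real n})" for x
      proof -
        have "((\<lambda>x. exp (- x) * (U x)\<^sup>2) has_real_derivative (w x - v x)) (at x)"
          by (auto intro!: derivative_eq_intros U simp: v_def w_def power2_eq_square algebra_simps)
        then show ?thesis
          by (simp add: has_real_derivative_iff_has_vector_derivative has_vector_derivative_at_within)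
      qed
      show "continuous_on {0..real n} (\<lambda>x. w x - v x)"
        by (intro continuous_intros continuous_on_subset [OF vc] continuous_on_subset [OF wc]) auto
    qed simp
    \<comment> \<open>Truncating to \<open>[0, n]\<close> leaves the boundary term
      \<open>exp (- n) * (U n)^2\<close>, which has the favourable sign, so no decay of
      \<open>U\<close> at infinity enters.\<close>
    then have "(LINT x|lborel. indicator {0..real n} x *\<^sub>R w x) -
        (LINT x|lborel. indicator {0..real n} x *\<^sub>R v x) \<ge> 0"
      using iv iw by (simp add: U right_diff_distrib)
    moreover have "(\<integral>\<^sup>+x. ennreal (v x) * indicator {0..real n} x \<partial>lborel) =
        ennreal (LINT x|lborel. indicator {0..real n} x *\<^sub>R v x)"
      using nn by (subst nn_integral_eq_integral [OF iv, symmetric])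
        (auto intro!: nn_integral_cong split: split_indicator)
    moreover have "(\<integral>\<^sup>+x. ennreal (w x) * indicator {0..real n} x \<partial>lborel) =
        ennreal (LINT x|lborel. indicator {0..real n} x *\<^sub>R w x)"
      using nn by (subst nn_integral_eq_integral [OF iw, symmetric])
        (auto intro!: nn_integral_cong split: split_indicator)
    ultimately have "(\<integral>\<^sup>+x. ennreal (v x) * indicator {0..real n} x \<partial>lborel) \<le>
        (\<integral>\<^sup>+x. ennreal (w x) * indicator {0..real n} x \<partial>lborel)"
      by (simp add: ennreal_leI)
    also have "\<dots> \<le> (\<integral>\<^sup>+x. ennreal (w x) * indicator {0..} x \<partial>lborel)"
      by (intro nn_integral_mono) (auto split: split_indicator)
    finally show ?thesis .
  qed
  have "(\<lambda>n. \<integral>\<^sup>+x. ennreal (v x) * indicator {0..real n} x \<partial>lborel) \<longlonglongrightarrow>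
      (\<integral>\<^sup>+x. ennreal (v x) * indicator {0..} x \<partial>lborel)"
  proof (rule nn_integral_LIMSEQ)
    show "incseq (\<lambda>n x. ennreal (v x) * indicator {0..real n} x)"
      by (auto simp: incseq_def le_fun_def split: split_indicator)
    fix x :: real
    obtain n0 :: nat where "x \<le> real n0" using real_arch_simple by blast
    then have "\<forall>\<^sub>F n in sequentially. ennreal (v x) * indicator {0..real n} x = ennreal (v x) * indicator {0..} x"
      by (intro eventually_sequentiallyI [of n0]) (auto split: split_indicator)
    then show "(\<lambda>n. ennreal (v x) * indicator {0..real n} x) \<longlonglongrightarrow> ennreal (v x) * indicator {0..} x"
      by (rule tendsto_eventually)
  qed simp
  then show ?thesis
    unfolding eq using le by (intro LIMSEQ_le_const2) auto
qed

text \<open>The squared norm is 1 for the constant \<open>laguerre 0\<close> and cannot grow along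
  the orbit of a contraction.\<close>

lemma nn_integral_laguerre_sq_le: "(\<integral>\<^sup>+x. ennreal ((laguerre n x)\<^sup>2) \<partial>exp_weight) \<le> 1"
proof (induction n)
  case 0
  then show ?case using nn_integral_exp_weight_1 by simp
next
  case (Suc n)
  have "(\<integral>\<^sup>+x. ennreal ((laguerre n x - (laguerre n x - laguerre (Suc n) x))\<^sup>2) \<partial>exp_weight) \<le>
      (\<integral>\<^sup>+x. ennreal ((laguerre n x)\<^sup>2) \<partial>exp_weight)"
    by (rule nn_integral_volterra_contraction)
      (auto intro!: derivative_eq_intros continuous_on_laguerre simp: laguerre'_def)
  then show ?case using Suc by simp
qed

text \<open>With \<open>t = m / (1 + m)\<close> the coefficients are \<open>(1 - t) * t ^ n\<close>.
  They come from the generating function \<open>exp (- t * x / (1 - t)) / (1 - t)\<close> of the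
  Laguerre polynomials, in which \<open>t / (1 - t) = m\<close>.\<close>

definition exp_remainder :: "real \<Rightarrow> nat \<Rightarrow> real \<Rightarrow> real" where
  "exp_remainder m N x = exp (- (m * x)) - (\<Sum>n<N. m ^ n / (1 + m) ^ Suc n * laguerre n x)"

lemma borel_measurable_exp_remainder [measurable]: "exp_remainder m N \<in> borel_measurable borel"
  unfolding exp_remainder_def [abs_def] by measurable

lemma geometric_step:
  fixes m :: real
  assumes "m > 0"
  shows "m ^ N / (1 + m) ^ Suc N + (m / (1 + m)) ^ Suc N = (m / (1 + m)) ^ N"
proof -
  have "m ^ N / (1 + m) ^ Suc N + (m / (1 + m)) ^ Suc N = (m / (1 + m)) ^ N * (1 / (1 + m) + m / (1 + m))"
    by (simp only: power_divide distrib_left power_Suc) (simp add: mult.commute)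
  also have "1 / (1 + m) + m / (1 + m) = 1"
    using assms by (simp add: add_divide_distrib [symmetric])
  finally show ?thesis by simp
qed

lemma exp_remainder_at_0:
  assumes "m > 0"
  shows "exp_remainder m N 0 = (m / (1 + m)) ^ N"
proof (induction N)
  case (Suc N)
  have "exp_remainder m (Suc N) 0 = (m / (1 + m)) ^ N - m ^ N / (1 + m) ^ Suc N"
    using Suc by (simp add: exp_remainder_def)
  also have "\<dots> = (m / (1 + m)) ^ Suc N"
    using geometric_step [OF assms, of N] by linarith
  finally show ?case .
qed (simp add: exp_remainder_def)

text \<open>Summation by parts: for \<open>t = m / (1 + m)\<close> the coefficients are the
  differences \<open>t ^ n - t ^ (n + 1)\<close>, and consecutive \<open>laguerre'\<close> differ by
  \<open>- laguerre n\<close>. This identity yields a primitive of \<open>exp_remainder\<close> in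
  closed form.\<close>

lemma sum_geometric_laguerre':
  assumes "m > 0"
  shows "(\<Sum>n<N. m ^ n / (1 + m) ^ Suc n * laguerre' n x) + (m / (1 + m)) ^ N * laguerre' N x =
    - m * (\<Sum>n<N. m ^ n / (1 + m) ^ Suc n * laguerre n x)"
proof (induction N)
  case 0
  then show ?case by (simp add: laguerre'_def)
next
  case (Suc N)
  have "laguerre' (Suc N) x = laguerre' N x - laguerre N x" by (simp add: laguerre'_def)
  moreover define a where "a = m ^ N / (1 + m) ^ Suc N"
  moreover have "(m / (1 + m)) ^ Suc N = m * a"
    by (simp add: a_def power_divide)
  moreover have "(m / (1 + m)) ^ N = a + m * a"
    using geometric_step [OF assms, of N] \<open>(m / (1 + m)) ^ Suc N = m * a\<close> by (simp add: a_def)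
  ultimately show ?case
    using Suc by (simp only: sum.lessThan_Suc a_def [symmetric]) (simp add: algebra_simps)
qed

text \<open>Each remainder is \<open>m / (1 + m)\<close> times the image of the previous one under the operator.\<close>

lemma nn_integral_exp_remainder_sq_le:
  assumes "m > 0"
  shows "(\<integral>\<^sup>+x. ennreal ((exp_remainder m N x)\<^sup>2) \<partial>exp_weight) \<le> ennreal (((m / (1 + m)) ^ N)\<^sup>2)"
proof (induction N)
  case 0
  have "(\<integral>\<^sup>+x. ennreal ((exp_remainder m 0 x)\<^sup>2) \<partial>exp_weight) \<le> (\<integral>\<^sup>+x. 1 \<partial>exp_weight)"
    using assms by (intro nn_integral_mono) (auto simp: exp_remainder_def power_le_one)
  also have "\<dots> = 1" by (rule nn_integral_exp_weight_1)
  finally show ?case by simp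
next
  case (Suc N)
  define t where "t = m / (1 + m)"
  have t: "t > 0" using assms by (simp add: t_def)
  \<comment> \<open>The primitive of the remainder that vanishes at 0. Its formula results from
    solving \<open>t * (exp_remainder m N x - U x) = exp_remainder m (Suc N) x\<close> for
    \<open>U x\<close>.\<close>
  define U where "U x = (t ^ N * laguerre N x - exp_remainder m N x) / m" for x
  have "exp_remainder m (Suc N) x = t * (exp_remainder m N x - U x)" for x
  proof -
    have "t * (exp_remainder m N x - U x) = t * (1 + 1 / m) * exp_remainder m N x - t / m * t ^ N * laguerre N x"
      using assms by (simp add: U_def field_simps)
    moreover have "t * (1 + 1 / m) = 1"
      using assms by (simp add: t_def field_simps add_pos_pos less_imp_neq [symmetric])
    moreover have "t / m * t ^ N = m ^ N / (1 + m) ^ Suc N"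
      using assms by (simp add: t_def power_divide)
    ultimately have "t * (exp_remainder m N x - U x) =
        exp_remainder m N x - m ^ N / (1 + m) ^ Suc N * laguerre N x"
      by (simp only: mult_1_left)
    then show ?thesis by (simp add: exp_remainder_def)
  qed
  then have "(\<integral>\<^sup>+x. ennreal ((exp_remainder m (Suc N) x)\<^sup>2) \<partial>exp_weight) =
      (\<integral>\<^sup>+x. ennreal (t\<^sup>2) * ennreal ((exp_remainder m N x - U x)\<^sup>2) \<partial>exp_weight)"
    by (simp add: power_mult_distrib ennreal_mult')
  also have "\<dots> = ennreal (t\<^sup>2) * (\<integral>\<^sup>+x. ennreal ((exp_remainder m N x - U x)\<^sup>2) \<partial>exp_weight)"
    unfolding U_def by (intro nn_integral_cmult borel_measurable_exp_weight) measurable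
  also have "\<dots> \<le> ennreal (t\<^sup>2) * (\<integral>\<^sup>+x. ennreal ((exp_remainder m N x)\<^sup>2) \<partial>exp_weight)"
  proof (intro mult_left_mono nn_integral_volterra_contraction)
    show "U 0 = 0" using exp_remainder_at_0 [OF assms] by (simp add: U_def t_def)
    show "continuous_on UNIV (exp_remainder m N)"
      unfolding exp_remainder_def [abs_def] by (intro continuous_intros continuous_on_laguerre)
    fix x
    have "(U has_real_derivative (t ^ N * laguerre' N x + m * exp (- (m * x)) +
        (\<Sum>n<N. m ^ n / (1 + m) ^ Suc n * laguerre' n x)) / m) (at x)"
      unfolding U_def [abs_def] exp_remainder_def
      using assms by (auto intro!: derivative_eq_intros DERIV_sum simp: mult.commute)
    also have "(t ^ N * laguerre' N x + m * exp (- (m * x)) +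
        (\<Sum>n<N. m ^ n / (1 + m) ^ Suc n * laguerre' n x)) / m = exp_remainder m N x"
    proof -
      have "t ^ N * laguerre' N x + (\<Sum>n<N. m ^ n / (1 + m) ^ Suc n * laguerre' n x) =
          - m * (\<Sum>n<N. m ^ n / (1 + m) ^ Suc n * laguerre n x)"
        using sum_geometric_laguerre' [OF assms, of x N] by (simp only: t_def add.commute)
      then have "t ^ N * laguerre' N x + m * exp (- (m * x)) +
          (\<Sum>n<N. m ^ n / (1 + m) ^ Suc n * laguerre' n x) = m * exp_remainder m N x"
        unfolding exp_remainder_def right_diff_distrib by linarith
      then show ?thesis using assms by simp
    qed
    finally show "(U has_real_derivative exp_remainder m N x) (at x)" .
  qed simp
  also have "\<dots> \<le> ennreal (t\<^sup>2) * ennreal ((t ^ N)\<^sup>2)"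
    using Suc by (intro mult_left_mono) (auto simp: t_def)
  also have "\<dots> = ennreal ((t ^ Suc N)\<^sup>2)"
    by (simp add: ennreal_mult' [symmetric] power_mult_distrib)
  finally show ?case by (simp add: t_def)
qed

text \<open>The factorials cancel against the moments, and the binomial theorem sums the powers of
  \<open>- 1 / (1 + m)\<close> to \<open>(m / (1 + m)) ^ n\<close>.\<close>

lemma integral_laguerre_mult_exp:
  assumes "m \<ge> 0"
  shows "(LINT x|exp_weight. laguerre n x * exp (- (m * x))) = m ^ n / (1 + m) ^ Suc n"
proof -
  have "has_bochner_integral exp_weight
      (\<lambda>x. \<Sum>k\<le>n. of_nat (n choose k) * ((- 1) ^ k / fact k) * (x ^ k * exp (- (m * x))))
      (\<Sum>k\<le>n. of_nat (n choose k) * ((- 1) ^ k / fact k) * (fact k / (1 + m) ^ Suc k))"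
    by (intro has_bochner_integral_sum has_bochner_integral_mult_right
        has_bochner_integral_exp_weight_moment assms)
  moreover have "(\<Sum>k\<le>n. of_nat (n choose k) * ((- 1) ^ k / fact k) * (fact k / (1 + m) ^ Suc k)) =
      m ^ n / (1 + m) ^ Suc n"
  proof -
    have "(\<Sum>k\<le>n. of_nat (n choose k) * ((- 1) ^ k / fact k) * (fact k / (1 + m) ^ Suc k)) =
        (\<Sum>k\<le>n. of_nat (n choose k) * (- (1 / (1 + m))) ^ k * 1 ^ (n - k)) * (1 / (1 + m))"
      unfolding sum_distrib_right
      by (intro sum.cong refl) (simp add: power_minus [of "1 / (1 + m)"] power_divide)
    also have "\<dots> = (- (1 / (1 + m)) + 1) ^ n * (1 / (1 + m))"
      by (simp only: binomial_ring)
    also have "- (1 / (1 + m)) + 1 = m / (1 + m)"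
      using assms by (simp add: field_simps)
    finally show ?thesis by (simp add: power_divide)
  qed
  ultimately show ?thesis
    by (simp add: laguerre_eq_sum sum_distrib_right mult.assoc has_bochner_integral_iff)
qed

section \<open>Pairings with square integrable functions\<close>

lemma exp_weight_sq_bound:
  fixes v :: "real \<Rightarrow> real"
  assumes v: "v \<in> borel_measurable borel" "(\<integral>\<^sup>+x. ennreal ((v x)\<^sup>2) \<partial>exp_weight) \<le> ennreal (s\<^sup>2)"
  shows "integrable exp_weight (\<lambda>x. (v x)\<^sup>2)" (is ?A)
    and "(LINT x|exp_weight. (v x)\<^sup>2) \<le> s\<^sup>2" (is ?B)
proof -
  have [measurable]: "v \<in> borel_measurable exp_weight"
    using v(1) by (rule borel_measurable_exp_weight)
  have "(\<integral>\<^sup>+x. ennreal ((v x)\<^sup>2) \<partial>exp_weight) < \<infinity>"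
    using v(2) by (rule le_less_trans) simp
  then show ?A by (intro integrableI_bounded) auto
  then have "ennreal (LINT x|exp_weight. (v x)\<^sup>2) \<le> ennreal (s\<^sup>2)"
    using v(2) by (subst nn_integral_eq_integral [symmetric]) auto
  then show ?B by (simp add: ennreal_le_iff)
qed

text \<open>Young's inequality weighted by \<open>s\<close>:
  \<open>|f| * |v| <= (s * |f|^2 + v^2 / s) / 2\<close>. As \<open>s\<close> bounds the norm of
  \<open>v\<close>, the result is linear in \<open>s\<close>, and smallness of \<open>v\<close>
  passes to the pairing.\<close>

lemma
  fixes f :: "real \<Rightarrow> complex" and v :: "real \<Rightarrow> real"
  assumes f: "f \<in> borel_measurable exp_weight" "integrable exp_weight (\<lambda>x. (cmod (f x))\<^sup>2)"
    and v: "v \<in> borel_measurable borel" "(\<integral>\<^sup>+x. ennreal ((v x)\<^sup>2) \<partial>exp_weight) \<le> ennreal (s\<^sup>2)"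
    and s: "s > 0"
  shows integrable_exp_weight_mult: "integrable exp_weight (\<lambda>x. f x * of_real (v x))"
    and integral_exp_weight_mult_le:
      "(LINT x|exp_weight. cmod (f x * of_real (v x))) \<le> s * ((LINT x|exp_weight. (cmod (f x))\<^sup>2) + 1) / 2"
proof -
  have vm [measurable]: "v \<in> borel_measurable exp_weight"
    using v(1) by (rule borel_measurable_exp_weight)
  note f(1) [measurable]
  have iv: "integrable exp_weight (\<lambda>x. (v x)\<^sup>2)"
    and vs: "(LINT x|exp_weight. (v x)\<^sup>2) \<le> s\<^sup>2"
    using exp_weight_sq_bound [OF v] by auto
  have i: "integrable exp_weight (\<lambda>x. (s * (cmod (f x))\<^sup>2 + (v x)\<^sup>2 / s) / 2)"
    using f(2) iv by auto
  have bound: "cmod (f x * of_real (v x)) \<le> (s * (cmod (f x))\<^sup>2 + (v x)\<^sup>2 / s) / 2" for x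
  proof -
    have "0 \<le> (s * cmod (f x) - \<bar>v x\<bar>)\<^sup>2" by simp
    then have "2 * s * (cmod (f x) * \<bar>v x\<bar>) \<le> s * (s * (cmod (f x))\<^sup>2) + (v x)\<^sup>2"
      by (simp add: power2_diff power_mult_distrib power2_eq_square [of s] mult_ac)
    then show ?thesis using s by (simp add: norm_mult field_simps power2_eq_square)
  qed
  show int: "integrable exp_weight (\<lambda>x. f x * of_real (v x))"
  proof (rule Bochner_Integration.integrable_bound [OF i])
    show "AE x in exp_weight. norm (f x * of_real (v x)) \<le> norm ((s * (cmod (f x))\<^sup>2 + (v x)\<^sup>2 / s) / 2)"
      unfolding real_norm_def by (intro AE_I2 order.trans [OF bound abs_ge_self])
  qed measurable
  have "(LINT x|exp_weight. cmod (f x * of_real (v x))) \<le>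
      (LINT x|exp_weight. (s * (cmod (f x))\<^sup>2 + (v x)\<^sup>2 / s) / 2)"
    using int i bound by (intro integral_mono) auto
  also have "\<dots> = (s * (LINT x|exp_weight. (cmod (f x))\<^sup>2) + (LINT x|exp_weight. (v x)\<^sup>2) / s) / 2"
    using f(2) iv by simp
  also have "\<dots> \<le> s * ((LINT x|exp_weight. (cmod (f x))\<^sup>2) + 1) / 2"
  proof -
    have "(LINT x|exp_weight. (v x)\<^sup>2) / s \<le> s"
      using vs s by (simp add: field_simps power2_eq_square)
    then show ?thesis unfolding distrib_left mult_1_right by (intro divide_right_mono add_left_mono) auto
  qed
  finally show "(LINT x|exp_weight. cmod (f x * of_real (v x))) \<le>
      s * ((LINT x|exp_weight. (cmod (f x))\<^sup>2) + 1) / 2" .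
qed

lemma integrable_mult_laguerre:
  assumes "f \<in> L2_exp_weight"
  shows "integrable exp_weight (\<lambda>x. f x * of_real (laguerre n x))"
  using assms nn_integral_laguerre_sq_le [of n]
  by (intro integrable_exp_weight_mult [of _ _ 1]) (auto simp: L2_exp_weight_def)

lemma nn_integral_exp_sq_le:
  assumes "m > 0"
  shows "(\<integral>\<^sup>+x. ennreal ((exp (- (m * x)))\<^sup>2) \<partial>exp_weight) \<le> ennreal (1\<^sup>2)"
  using nn_integral_exp_remainder_sq_le [OF assms, of 0] by (simp add: exp_remainder_def)

text \<open>Parseval's identity for \<open>f\<close> and an exponential. What the first
  \<open>N\<close> terms miss is the pairing of \<open>f\<close> with
  \<open>exp_remainder m N\<close>, which decays geometrically.\<close>

lemma laguerre_coeff_sums_integral_exp: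
  assumes f: "f \<in> L2_exp_weight" and m: "m > 0"
  shows "(\<lambda>n. laguerre_coeff f n * of_real (m ^ n / (1 + m) ^ Suc n)) sums
    (LINT x|exp_weight. f x * of_real (exp (- (m * x))))"
proof -
  define t where "t = m / (1 + m)"
  have t: "0 < t" "t < 1" using m by (auto simp: t_def)
  define I where "I = (LINT x|exp_weight. f x * of_real (exp (- (m * x))))"
  define S where "S N = (\<Sum>n<N. laguerre_coeff f n * of_real (m ^ n / (1 + m) ^ Suc n))" for N
  have fm: "f \<in> borel_measurable exp_weight" "integrable exp_weight (\<lambda>x. (cmod (f x))\<^sup>2)"
    using f by (auto simp: L2_exp_weight_def)
  have ih: "integrable exp_weight (\<lambda>x. f x * of_real (exp (- (m * x))))"
    by (rule integrable_exp_weight_mult [OF fm _ nn_integral_exp_sq_le [OF m]]) auto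
  define C where "C = ((LINT x|exp_weight. (cmod (f x))\<^sup>2) + 1) / 2"
  have "cmod (S N - I) \<le> t ^ N * C" for N
  proof -
    have il: "integrable exp_weight (\<lambda>x. f x * of_real (laguerre n x) * of_real (m ^ n / (1 + m) ^ Suc n))" for n
      by (intro integrable_mult_left integrable_mult_laguerre f)
    have "S N = (\<Sum>n<N. LINT x|exp_weight. f x * of_real (laguerre n x) * of_real (m ^ n / (1 + m) ^ Suc n))"
      unfolding S_def laguerre_coeff_def
      by (intro sum.cong refl integral_mult_left_zero [symmetric])
    also have "\<dots> = (LINT x|exp_weight. (\<Sum>n<N. f x * of_real (laguerre n x) * of_real (m ^ n / (1 + m) ^ Suc n)))"
      by (rule Bochner_Integration.integral_sum [symmetric]) (rule il)
    finally have "I - S N = (LINT x|exp_weight. f x * of_real (exp (- (m * x))) -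
        (\<Sum>n<N. f x * of_real (laguerre n x) * of_real (m ^ n / (1 + m) ^ Suc n)))"
      unfolding I_def by (simp only: Bochner_Integration.integral_diff [OF ih Bochner_Integration.integrable_sum] il)
    also have "\<dots> = (LINT x|exp_weight. f x * of_real (exp_remainder m N x))"
      unfolding exp_remainder_def of_real_diff of_real_sum of_real_mult right_diff_distrib sum_distrib_left
      by (simp only: mult_ac)
    finally have "cmod (I - S N) = cmod (LINT x|exp_weight. f x * of_real (exp_remainder m N x))"
      by (rule arg_cong)
    also have "\<dots> \<le> (LINT x|exp_weight. cmod (f x * of_real (exp_remainder m N x)))"
      by (rule integral_norm_bound)
    also have "\<dots> \<le> t ^ N * ((LINT x|exp_weight. (cmod (f x))\<^sup>2) + 1) / 2"
      using t nn_integral_exp_remainder_sq_le [OF m, of N]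
      by (intro integral_exp_weight_mult_le fm) (auto simp: t_def)
    finally show ?thesis by (simp add: C_def norm_minus_commute)
  qed
  then have "\<forall>\<^sub>F N in sequentially. cmod (S N - I) \<le> t ^ N * C"
    by simp
  moreover have "(\<lambda>N. t ^ N * C) \<longlonglongrightarrow> 0"
    using t by (intro tendsto_mult_left_zero LIMSEQ_power_zero) simp
  ultimately have "(\<lambda>N. S N - I) \<longlonglongrightarrow> 0"
    by (rule Lim_null_comparison)
  then show ?thesis
    unfolding sums_def S_def I_def by (rule LIM_zero_cancel)
qed

section \<open>Series with absolutely summable coefficients\<close>

definition laguerre_series :: "(nat \<Rightarrow> complex) \<Rightarrow> nat \<Rightarrow> real \<Rightarrow> complex" where
  "laguerre_series c n x = (\<Sum>k. c k * of_real (laguerre (k + n) x))"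

lemma summable_laguerre_series:
  assumes "summable (\<lambda>k. cmod (c k))" "x \<ge> 0"
  shows "summable (\<lambda>k. cmod (c k * of_real (laguerre (k + n) x)))"
proof (rule summable_comparison_test')
  show "summable (\<lambda>k. cmod (c k) * exp x)" using assms(1) by (rule summable_mult2)
  show "norm (cmod (c k * of_real (laguerre (k + n) x))) \<le> cmod (c k) * exp x" for k
    using abs_laguerre_le [OF assms(2)] by (simp add: norm_mult mult_left_mono)
qed

text \<open>For \<open>c = laguerre_coeff f\<close> this is the same series as in
  \<open>laguerre_coeff_sums_integral_exp\<close>, so \<open>f\<close> and its Laguerre series have
  equal pairings. Termwise integration is allowed because \<open>laguerre k x\<close> and
  \<open>exp (- (m * x))\<close> both have norm at most 1, so their product has integral norm at
  most 1.\<close>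

lemma laguerre_series_mult_exp:
  assumes c: "summable (\<lambda>k. cmod (c k))" and m: "m > 0"
  shows "integrable exp_weight (\<lambda>x. laguerre_series c 0 x * of_real (exp (- (m * x))))" (is ?A)
    and "(\<lambda>n. c n * of_real (m ^ n / (1 + m) ^ Suc n)) sums
      (LINT x|exp_weight. laguerre_series c 0 x * of_real (exp (- (m * x))))" (is ?B)
proof -
  define g where "g k x = c k * of_real (laguerre k x) * of_real (exp (- (m * x)))" for k x
  have int: "integrable exp_weight (\<lambda>x. of_real (laguerre k x) * of_real (exp (- (m * x))) :: complex)"
    and le: "(LINT x|exp_weight. cmod (of_real (laguerre k x) * of_real (exp (- (m * x))))) \<le> 1" for k
  proof -
    have L: "(\<lambda>x. complex_of_real (laguerre k x)) \<in> borel_measurable exp_weight"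
      by (rule borel_measurable_exp_weight) measurable
    have "integrable exp_weight (\<lambda>x. (laguerre k x)\<^sup>2)" "(LINT x|exp_weight. (laguerre k x)\<^sup>2) \<le> 1\<^sup>2"
      using exp_weight_sq_bound [OF borel_measurable_laguerre, of k 1] nn_integral_laguerre_sq_le [of k]
      by simp_all
    then have L2: "integrable exp_weight (\<lambda>x. (cmod (complex_of_real (laguerre k x)))\<^sup>2)"
        "(LINT x|exp_weight. (cmod (complex_of_real (laguerre k x)))\<^sup>2) \<le> 1"
      by simp_all
    have E: "(\<lambda>x. exp (- (m * x))) \<in> borel_measurable borel" by measurable
    show "integrable exp_weight (\<lambda>x. of_real (laguerre k x) * of_real (exp (- (m * x))) :: complex)"
      by (rule integrable_exp_weight_mult [OF L L2(1) E nn_integral_exp_sq_le [OF m] zero_less_one])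
    have "(LINT x|exp_weight. cmod (of_real (laguerre k x) * of_real (exp (- (m * x))))) \<le>
        1 * ((LINT x|exp_weight. (cmod (complex_of_real (laguerre k x)))\<^sup>2) + 1) / 2"
      by (rule integral_exp_weight_mult_le [OF L L2(1) E nn_integral_exp_sq_le [OF m] zero_less_one])
    also have "\<dots> \<le> 1" using L2(2) by simp
    finally show "(LINT x|exp_weight. cmod (of_real (laguerre k x) * of_real (exp (- (m * x))))) \<le> 1" .
  qed
  have ig: "integrable exp_weight (g k)" for k
    unfolding g_def [abs_def] mult.assoc by (intro integrable_mult_right int)
  have gs: "AE x in exp_weight. summable (\<lambda>k. norm (g k x))"
  proof (rule AE_I2)
    fix x assume "x \<in> space exp_weight"
    then have "summable (\<lambda>k. cmod (c k * of_real (laguerre (k + 0) x)))"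
      by (intro summable_laguerre_series c) simp
    then show "summable (\<lambda>k. norm (g k x))"
      unfolding g_def norm_mult [of _ "of_real (exp (- (m * x)))"] add_0_right by (rule summable_mult2)
  qed
  have gn: "summable (\<lambda>k. LINT x|exp_weight. norm (g k x))"
  proof (rule summable_comparison_test' [OF c])
    fix k
    have "(LINT x|exp_weight. norm (g k x)) =
        cmod (c k) * (LINT x|exp_weight. cmod (of_real (laguerre k x) * of_real (exp (- (m * x)))))"
      unfolding g_def mult.assoc norm_mult [of "c k"] by (rule integral_mult_right_zero)
    also have "\<dots> \<le> cmod (c k) * 1" by (intro mult_left_mono le) auto
    finally show "norm (LINT x|exp_weight. norm (g k x)) \<le> cmod (c k)" by simp
  qed
  have sum: "(\<Sum>k. g k x) = laguerre_series c 0 x * of_real (exp (- (m * x)))" if "x \<in> space exp_weight" for x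
  proof -
    have "summable (\<lambda>k. c k * of_real (laguerre (k + 0) x))"
      using that by (intro summable_norm_cancel [OF summable_laguerre_series [OF c]]) simp
    from suminf_mult2 [OF this] show ?thesis
      unfolding g_def laguerre_series_def add_0_right by (rule sym)
  qed
  have "integrable exp_weight (\<lambda>x. \<Sum>k. g k x)" by (rule integrable_suminf [OF ig gs gn])
  moreover have "integrable exp_weight (\<lambda>x. \<Sum>k. g k x) \<longleftrightarrow>
      integrable exp_weight (\<lambda>x. laguerre_series c 0 x * of_real (exp (- (m * x))))"
    by (rule Bochner_Integration.integrable_cong [OF refl sum])
  ultimately show ?A by blast
  have "(\<lambda>k. LINT x|exp_weight. g k x) sums (LINT x|exp_weight. (\<Sum>k. g k x))"
    by (rule sums_integral [OF ig gs gn])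
  moreover have "(LINT x|exp_weight. (\<Sum>k. g k x)) =
      (LINT x|exp_weight. laguerre_series c 0 x * of_real (exp (- (m * x))))"
    by (rule Bochner_Integration.integral_cong [OF refl sum])
  moreover have "(LINT x|exp_weight. g k x) = c k * of_real (m ^ k / (1 + m) ^ Suc k)" for k
  proof -
    have "(LINT x|exp_weight. g k x) =
        c k * (LINT x|exp_weight. complex_of_real (laguerre k x * exp (- (m * x))))"
      unfolding g_def mult.assoc of_real_mult by (rule integral_mult_right_zero)
    also have "\<dots> = c k * of_real (m ^ k / (1 + m) ^ Suc k)"
      using m by (simp only: integral_complex_of_real integral_laguerre_mult_exp less_imp_le)
    finally show ?thesis .
  qed
  ultimately show ?B by (simp only:)
qed

lemma AE_eq_laguerre_series:
  assumes f: "f \<in> L2_exp_weight" and c: "summable (\<lambda>n. cmod (laguerre_coeff f n))"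
  shows "AE x in exp_weight. f x = laguerre_series (laguerre_coeff f) 0 x"
proof -
  define F where "F = laguerre_series (laguerre_coeff f) 0"
  have fm: "f \<in> borel_measurable exp_weight" "integrable exp_weight (\<lambda>x. (cmod (f x))\<^sup>2)"
    using f by (auto simp: L2_exp_weight_def)
  have 1: "integrable exp_weight (\<lambda>x. (f x - F x) * of_real (exp (- (m * x))))"
    and 2: "(LINT x|exp_weight. (f x - F x) * of_real (exp (- (m * x)))) = 0" if m: "m > 0" for m
  proof -
    have i1: "integrable exp_weight (\<lambda>x. f x * of_real (exp (- (m * x))))"
      by (rule integrable_exp_weight_mult [OF fm _ nn_integral_exp_sq_le [OF m]]) auto
    have i2: "integrable exp_weight (\<lambda>x. F x * of_real (exp (- (m * x))))"
      unfolding F_def by (rule laguerre_series_mult_exp [OF c m])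
    show "integrable exp_weight (\<lambda>x. (f x - F x) * of_real (exp (- (m * x))))"
      unfolding left_diff_distrib using i1 i2 by (rule Bochner_Integration.integrable_diff)
    have "(LINT x|exp_weight. f x * of_real (exp (- (m * x)))) =
        (LINT x|exp_weight. F x * of_real (exp (- (m * x))))"
      unfolding F_def
      by (rule sums_unique2 [OF laguerre_coeff_sums_integral_exp [OF f m] laguerre_series_mult_exp(2) [OF c m]])
    then show "(LINT x|exp_weight. (f x - F x) * of_real (exp (- (m * x)))) = 0"
      unfolding left_diff_distrib by (simp only: Bochner_Integration.integral_diff [OF i1 i2] diff_self)
  qed
  \<comment> \<open>One exponential factor is absorbed into \<open>r\<close>, so that every moment,
    the zeroth included, is a pairing with \<open>exp (- (m * x))\<close> for
    \<open>m = i + 1 > 0\<close>.\<close>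
  define r where "r x = (f x - F x) * of_real (exp (- (1 * x)))" for x
  have eq: "r x * of_real (exp (- x) ^ i) = (f x - F x) * of_real (exp (- (real (Suc i) * x)))" for x i
  proof -
    have "exp (- (real (Suc i) * x)) = exp (- (1 * x)) * exp (- x) ^ i"
      using exp_of_nat_mult [of "Suc i" "- x"] by simp
    then show ?thesis by (simp only: r_def of_real_mult mult.assoc)
  qed
  have "AE x in exp_weight. r x = 0"
  proof (rule exp_weight_moment_unique_complex, unfold eq)
    show "integrable exp_weight r" unfolding r_def by (rule 1) simp
    show "integrable exp_weight (\<lambda>x. (f x - F x) * of_real (exp (- (real (Suc i) * x))))" for i
      by (rule 1) simp
    show "(LINT x|exp_weight. (f x - F x) * of_real (exp (- (real (Suc i) * x)))) = 0" for i
      by (rule 2) simp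
  qed
  then show ?thesis by eventually_elim (simp add: r_def F_def)
qed

section \<open>Iterates of the operator\<close>

lemma volterra_T_eq:
  "volterra_T g x = g x - (LINT y|lebesgue_on {0..}. indicator {0..x} y *\<^sub>R g y)"
proof -
  have "(\<lambda>y. indicator {0..} y *\<^sub>R indicator {0..x} y *\<^sub>R g y) = (\<lambda>y. indicator {0..x} y *\<^sub>R g y)"
    by (auto simp: fun_eq_iff split: split_indicator)
  moreover have "{0..} \<inter> space lebesgue \<in> sets (lebesgue :: real measure)" by simp
  ultimately show ?thesis
    by (simp only: volterra_T_def set_lebesgue_integral_def integral_restrict_space)
qed

lemma integral_lebesgue_on_Icc:
  fixes g :: "real \<Rightarrow> real"
  assumes "continuous_on UNIV g" "\<And>y. (G has_real_derivative g y) (at y)" "x \<ge> 0"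
  shows "has_bochner_integral (lebesgue_on {0..}) (\<lambda>y. indicator {0..x} y * g y) (G x - G 0)"
proof -
  have i: "integrable lborel (\<lambda>y. indicator {0..x} y *\<^sub>R g y)"
    by (intro borel_integrable_compact compact_Icc continuous_on_subset [OF assms(1)]) auto
  have "(LINT y|lborel. indicator {0..x} y *\<^sub>R g y) = G x - G 0"
    by (rule integral_FTC_atLeastAtMost [OF assms(3)])
      (use assms in \<open>auto intro: has_vector_derivative_at_within continuous_on_subset
        simp: has_real_derivative_iff_has_vector_derivative\<close>)
  moreover have "(\<lambda>y. indicator {0..} y *\<^sub>R (indicator {0..x} y * g y)) = (\<lambda>y. indicator {0..x} y *\<^sub>R g y)"
    by (auto simp: fun_eq_iff split: split_indicator)
  moreover have "{0..} \<inter> space lebesgue \<in> sets (lebesgue :: real measure)" by simp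
  moreover have "(\<lambda>y. indicator {0..x} y *\<^sub>R g y) \<in> borel_measurable lborel"
    using i by (rule borel_measurable_integrable)
  ultimately show ?thesis
    using i by (simp only: has_bochner_integral_iff integrable_restrict_space integral_restrict_space
        integrable_completion integral_completion simp_thms)
qed

lemma integral_laguerre_series:
  assumes c: "summable (\<lambda>k. cmod (c k))" and x: "x \<ge> 0"
  shows "(\<lambda>y. indicator {0..x} y *\<^sub>R laguerre_series c n y) \<in> borel_measurable (lebesgue_on {0..})" (is ?A)
    and "(LINT y|lebesgue_on {0..}. indicator {0..x} y *\<^sub>R laguerre_series c n y) =
      laguerre_series c n x - laguerre_series c (Suc n) x" (is ?B)
proof -
  define g where "g k y = c k * of_real (indicator {0..x} y * laguerre (k + n) y)" for k y
  have hb: "has_bochner_integral (lebesgue_on {0..}) (\<lambda>y. indicator {0..x} y * laguerre k y)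
      (laguerre k x - laguerre (Suc k) x)" for k
  proof -
    have "((\<lambda>y. laguerre k y - laguerre (Suc k) y) has_real_derivative laguerre k y) (at y)" for y
      by (auto intro!: derivative_eq_intros simp: laguerre'_def)
    from integral_lebesgue_on_Icc [OF continuous_on_laguerre this x] show ?thesis by simp
  qed
  have hg: "has_bochner_integral (lebesgue_on {0..}) (g k)
      (c k * of_real (laguerre (k + n) x - laguerre (Suc (k + n)) x))" for k
    unfolding g_def [abs_def]
    by (intro has_bochner_integral_mult_right has_bochner_integral_of_real hb)
  then have ig: "integrable (lebesgue_on {0..}) (g k)" for k by (auto simp: has_bochner_integral_iff)
  have gs: "AE y in lebesgue_on {0..}. summable (\<lambda>k. norm (g k y))"
  proof (rule AE_I2)
    fix y :: real assume "y \<in> space (lebesgue_on {0..})"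
    then show "summable (\<lambda>k. norm (g k y))"
      using summable_mult2 [OF summable_laguerre_series [OF c, of y n], of "indicator {0..x} y"]
      by (auto simp: g_def norm_mult split: split_indicator)
  qed
  have h1: "has_bochner_integral (lebesgue_on {0..}) (\<lambda>y. indicator {0..x} y * 1) (x - 0)"
    by (rule integral_lebesgue_on_Icc) (auto intro!: derivative_eq_intros x)
  \<comment> \<open>On \<open>[0, x]\<close> every polynomial is bounded by \<open>exp x\<close>,
    which dominates the integrals of the terms by a multiple of \<open>cmod (c k)\<close>.\<close>
  have gn: "summable (\<lambda>k. LINT y|lebesgue_on {0..}. norm (g k y))"
  proof (rule summable_comparison_test')
    show "summable (\<lambda>k. cmod (c k) * (exp x * x))" using c by (rule summable_mult2)
    fix k
    have "norm (g k y) \<le> cmod (c k) * exp x * (indicator {0..x} y * 1)" if "y \<in> space (lebesgue_on {0..})" for y :: real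
    proof (cases "y \<in> {0..x}")
      case True
      then have "\<bar>laguerre (k + n) y\<bar> \<le> exp y" by (intro abs_laguerre_le) auto
      also have "\<dots> \<le> exp x" using True by simp
      finally show ?thesis using True by (simp add: g_def norm_mult mult_left_mono)
    qed (simp add: g_def)
    then have "(LINT y|lebesgue_on {0..}. norm (g k y)) \<le>
        (LINT y|lebesgue_on {0..}. cmod (c k) * exp x * (indicator {0..x} y * 1))"
      using ig h1 by (intro integral_mono integrable_norm integrable_mult_right) (auto simp: has_bochner_integral_iff)
    also have "\<dots> = cmod (c k) * (exp x * x)"
      using h1 by (simp add: has_bochner_integral_iff)
    finally show "norm (LINT y|lebesgue_on {0..}. norm (g k y)) \<le> cmod (c k) * (exp x * x)" by simp
  qed
  have sum: "(\<Sum>k. g k y) = indicator {0..x} y *\<^sub>R laguerre_series c n y" for y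
    by (cases "y \<in> {0..x}") (auto simp: g_def laguerre_series_def)
  have "integrable (lebesgue_on {0..}) (\<lambda>y. \<Sum>k. g k y)" by (rule integrable_suminf [OF ig gs gn])
  then show ?A unfolding sum by simp
  have "(\<lambda>k. LINT y|lebesgue_on {0..}. g k y) sums (LINT y|lebesgue_on {0..}. (\<Sum>k. g k y))"
    by (rule sums_integral [OF ig gs gn])
  moreover have "(LINT y|lebesgue_on {0..}. g k y) =
      c k * of_real (laguerre (k + n) x) - c k * of_real (laguerre (k + Suc n) x)" for k
    using hg [of k] by (simp add: has_bochner_integral_iff right_diff_distrib)
  ultimately have "(\<lambda>k. c k * of_real (laguerre (k + n) x) - c k * of_real (laguerre (k + Suc n) x)) sums
      (LINT y|lebesgue_on {0..}. indicator {0..x} y *\<^sub>R laguerre_series c n y)"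
    by (simp add: sum)
  moreover have "(\<lambda>k. c k * of_real (laguerre (k + n) x) - c k * of_real (laguerre (k + Suc n) x)) sums
      (laguerre_series c n x - laguerre_series c (Suc n) x)"
    unfolding laguerre_series_def
    by (intro sums_diff summable_sums summable_norm_cancel [OF summable_laguerre_series [OF c x]])
  ultimately show ?B by (rule sums_unique2)
qed

text \<open>The operator changes a function at \<open>x\<close> only by an integral, which ignores
  null sets, so the difference between \<open>f\<close> and its series is carried along unchanged.
  Keeping it as an explicit summand makes the formula exact at every \<open>x >= 0\<close>, and the
  exceptional set is the same for all \<open>n\<close>.\<close>

lemma funpow_volterra_T_eq:
  assumes c: "summable (\<lambda>k. cmod (c k))"
    and f: "f \<in> borel_measurable (lebesgue_on {0..})"
    and ae: "AE x in lebesgue_on {0..}. f x = laguerre_series c 0 x"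
    and "x \<ge> 0"
  shows "(volterra_T ^^ n) f x = laguerre_series c n x + (f x - laguerre_series c 0 x)"
  using \<open>x \<ge> 0\<close>
proof (induction n arbitrary: x)
  case (Suc n)
  note f [measurable]
  have "(LINT y|lebesgue_on {0..}. indicator {0..x} y *\<^sub>R (volterra_T ^^ n) f y) =
      (LINT y|lebesgue_on {0..}. indicator {0..x} y *\<^sub>R laguerre_series c n y +
        (indicator {0..x} y *\<^sub>R f y - indicator {0..x} y *\<^sub>R laguerre_series c 0 y))"
    using Suc.IH by (intro Bochner_Integration.integral_cong) (auto split: split_indicator)
  also have "\<dots> = (LINT y|lebesgue_on {0..}. indicator {0..x} y *\<^sub>R laguerre_series c n y)"
  proof (rule integral_cong_AE)
    have [measurable]: "{0..x} \<in> sets (lebesgue_on {0..})"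
      by (auto simp: sets_restrict_space_iff)
    have "(\<lambda>y. indicator {0..x} y *\<^sub>R f y) \<in> borel_measurable (lebesgue_on {0..})" by measurable
    then show "(\<lambda>y. indicator {0..x} y *\<^sub>R laguerre_series c n y +
        (indicator {0..x} y *\<^sub>R f y - indicator {0..x} y *\<^sub>R laguerre_series c 0 y))
        \<in> borel_measurable (lebesgue_on {0..})"
      by (intro borel_measurable_add borel_measurable_diff integral_laguerre_series c Suc.prems)
    show "(\<lambda>y. indicator {0..x} y *\<^sub>R laguerre_series c n y) \<in> borel_measurable (lebesgue_on {0..})"
      by (intro integral_laguerre_series c Suc.prems)
    show "AE y in lebesgue_on {0..}. indicator {0..x} y *\<^sub>R laguerre_series c n y +
        (indicator {0..x} y *\<^sub>R f y - indicator {0..x} y *\<^sub>R laguerre_series c 0 y) =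
        indicator {0..x} y *\<^sub>R laguerre_series c n y"
      using ae by eventually_elim simp
  qed
  also have "\<dots> = laguerre_series c n x - laguerre_series c (Suc n) x"
    by (rule integral_laguerre_series [OF c Suc.prems])
  finally show ?case
    using Suc by (simp add: volterra_T_eq [of "(volterra_T ^^ n) f"])
qed simp

text \<open>Summing over \<open>n\<close> first multiplies each \<open>c k\<close> by a sum of
  consecutive polynomials. Since \<open>C\<close> does not depend on \<open>k\<close>, the sum of
  the \<open>cmod (c k)\<close> factors out.\<close>

lemma norm_sum_laguerre_series_le:
  assumes c: "summable (\<lambda>k. cmod (c k))" and x: "x \<ge> 0"
    and C: "\<And>k N. \<bar>\<Sum>n<N. laguerre (k + n) x\<bar> \<le> C * sqrt (real N)"
  shows "cmod (\<Sum>n<N. laguerre_series c n x) \<le> (\<Sum>k. cmod (c k)) * C * sqrt (real N)"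
proof -
  have "(\<lambda>k. \<Sum>n<N. c k * of_real (laguerre (k + n) x)) sums (\<Sum>n<N. laguerre_series c n x)"
    unfolding laguerre_series_def
    by (intro sums_sum summable_sums summable_norm_cancel [OF summable_laguerre_series [OF c x]])
  then have "(\<lambda>k. c k * of_real (\<Sum>n<N. laguerre (k + n) x)) sums (\<Sum>n<N. laguerre_series c n x)"
    by (simp add: sum_distrib_left)
  then have eq: "(\<Sum>n<N. laguerre_series c n x) = (\<Sum>k. c k * of_real (\<Sum>n<N. laguerre (k + n) x))"
    by (simp add: sums_iff)
  have "cmod (\<Sum>k. c k * of_real (\<Sum>n<N. laguerre (k + n) x)) \<le> (\<Sum>k. cmod (c k) * (C * sqrt (real N)))"
  proof (rule norm_suminf_le)
    show "norm (c k * of_real (\<Sum>n<N. laguerre (k + n) x)) \<le> cmod (c k) * (C * sqrt (real N))" for k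
      unfolding norm_mult norm_of_real by (intro mult_left_mono C) auto
    show "summable (\<lambda>k. cmod (c k) * (C * sqrt (real N)))" using c by (rule summable_mult2)
  qed
  also have "\<dots> = (\<Sum>k. cmod (c k)) * (C * sqrt (real N))"
    using suminf_mult2 [OF c] by simp
  finally show ?thesis by (simp add: eq mult.assoc)
qed

theorem corollary1p5:
  fixes f :: "real \<Rightarrow> complex" and \<eta> :: real
  assumes "f \<in> L2_exp_weight"
    and "summable (\<lambda>n. cmod (laguerre_coeff f n))"
    and "\<eta> > 0"
  shows "AE x in lebesgue_on {0..}.
    (\<lambda>N. sqrt (real N) / ln (1 + real N) powr (3 / 2 + \<eta>) *
       cmod (1 / of_nat N * (\<Sum>n<N. (volterra_T ^^ n) f x))) \<longlonglongrightarrow> 0"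
proof -
  define c where "c = laguerre_coeff f"
  have c: "summable (\<lambda>k. cmod (c k))" using assms(2) by (simp add: c_def)
  have f: "f \<in> borel_measurable (lebesgue_on {0..})"
    using assms(1) by (simp add: L2_exp_weight_def measurable_cong_sets [OF sets_exp_weight refl])
  have ae: "AE x in lebesgue_on {0..}. f x = laguerre_series c 0 x"
    using AE_eq_laguerre_series [OF assms(1,2)] by (simp add: AE_exp_weight_iff c_def)
  \<comment> \<open>The origin has to be removed: every \<open>laguerre n\<close> equals 1 there, so
    the sums over \<open>n < N\<close> are \<open>N\<close> and no bound of order
    \<open>sqrt N\<close> exists.\<close>
  have "AE x in lebesgue. x \<notin> {0::real}"
    by (rule AE_not_in) (use negligible_sing negligible_iff_null_sets in blast)
  then have "AE x in lebesgue_on {0..}. x > (0::real)"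
    by (simp add: AE_restrict_space_iff) (erule eventually_mono, simp)
  with ae show ?thesis
  proof eventually_elim
    fix x :: real assume fx: "f x = laguerre_series c 0 x" and x: "x > 0"
    obtain C where C: "\<And>k N. \<bar>\<Sum>n<N. laguerre (k + n) x\<bar> \<le> C * sqrt (real N)"
      using abs_sum_laguerre_le [OF x] by blast
    define K where "K = (\<Sum>k. cmod (c k)) * C"
    define p where "p = 3 / 2 + \<eta>"
    have p: "p > 0" using assms(3) by (simp add: p_def)
    have bound: "cmod (\<Sum>n<N. (volterra_T ^^ n) f x) \<le> K * sqrt (real N)" for N
    proof -
      have "(volterra_T ^^ n) f x = laguerre_series c n x" for n
        using funpow_volterra_T_eq [OF c f ae less_imp_le [OF x]] fx by simp
      then show ?thesis
        using norm_sum_laguerre_series_le [OF c less_imp_le [OF x] C] by (simp only: K_def)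
    qed
    have "(\<lambda>N. K / ln (1 + real N) powr p) \<longlonglongrightarrow> 0"
    proof -
      have "filterlim (\<lambda>N. ln (1 + real N)) at_top sequentially"
        by (intro filterlim_compose [OF ln_at_top] filterlim_tendsto_add_at_top [OF tendsto_const]
            filterlim_real_sequentially)
      then have "(\<lambda>N. K * ln (1 + real N) powr (- p)) \<longlonglongrightarrow> 0"
        using p by (intro tendsto_mult_right_zero tendsto_neg_powr) auto
      then show ?thesis by (simp add: powr_minus_divide)
    qed
    moreover have "norm (sqrt (real N) / ln (1 + real N) powr p *
        cmod (1 / of_nat N * (\<Sum>n<N. (volterra_T ^^ n) f x))) \<le> K / ln (1 + real N) powr p" if "N > 0" for N
    proof -
      have "sqrt (real N) * (cmod (\<Sum>n<N. (volterra_T ^^ n) f x) / real N) \<le>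
          sqrt (real N) * (K * sqrt (real N) / real N)"
        by (intro mult_left_mono divide_right_mono bound) auto
      also have "\<dots> = K * (sqrt (real N) * sqrt (real N)) / real N" by (simp only: mult_ac times_divide_eq_right)
      also have "\<dots> = K" using that by simp
      finally have "sqrt (real N) * (cmod (\<Sum>n<N. (volterra_T ^^ n) f x) / real N) / ln (1 + real N) powr p
          \<le> K / ln (1 + real N) powr p"
        by (rule divide_right_mono) simp
      then show ?thesis by (simp add: norm_mult norm_divide mult.commute)
    qed
    ultimately show "(\<lambda>N. sqrt (real N) / ln (1 + real N) powr (3 / 2 + \<eta>) *
        cmod (1 / of_nat N * (\<Sum>n<N. (volterra_T ^^ n) f x))) \<longlonglongrightarrow> 0"
      unfolding p_def [symmetric]
      by (rule Lim_null_comparison [OF eventually_mono [OF eventually_gt_at_top], rotated])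
  qed
qed

end
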